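(* Let $k$ be a positive integer. (i) If $\alpha$ is not an integer with $0<\alpha<k$, and $0<\beta\le\min(\alpha,1)$, then $\mathcal{P}_\alpha(\mathbb{R}^d)$ is complete with respect to the probability metric $$F_{\alpha,\beta}(\mu,\nu)=d_\beta(\mu,\nu)+\|\widehat\mu-\widehat\nu\|_{\alpha,k}.$$ (ii) Assume that $k$ is odd and either $\alpha$ is not an integer with $0<\alpha<k+1$, or $\alpha=k$. Let $0<\beta\le\min(\alpha,1)$. Then $\mathcal{P}_\alpha(\mathbb{R}^d)$ is complete with respect to the probability metric $$H_{\alpha,\beta}(\mu,\nu)=d_\beta(\mu,\nu)+\|\Re\,\widehat\mu-\Re\,\widehat\nu\|_{\alpha,k}.$$
   Context: Let $d\ge 1$ and let $|\cdot|$ denote the Euclidean norm on $\mathbb{R}^d$. $\mathcal{P}(\mathbb{R}^d)$ is the set of Borel probability measures on $\mathbb{R}^d$ and, for $\alpha>0$, $\mathcal{P}_\alpha(\mathbb{R}^d)=\{\mu\in\mathcal{P}(\mathbb{R}^d):\int_{\mathbb{R}^d}|v|^\alpha d\mu(v)<\infty\}$. The Fourier transform of $\mu$ is $\widehat\mu(\xi)=\int_{\mathbb{R}^d}e^{-i\xi\cdot v}d\mu(v)$. For a scalar function $\phi$ on $\mathbb{R}^d$, $\Delta_\xi^k(\phi)(0)=\sum_{m=0}^k\binom km(-1)^{k-m}\phi(m\xi)$, and $$\|\phi\|_{\alpha,k}=\int_{\mathbb{R}^d}\frac{|\Delta_\xi^k(\phi)(0)|}{|\xi|^{d+\alpha}}\,d\xi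 .$$ For $\beta>0$, $d_\beta(\mu,\nu)=\sup_{\xi\neq 0}\frac{|\widehat\mu(\xi)-\widehat\nu(\xi)|}{|\xi|^\beta}$. $\Re$ denotes the pointwise real part. A probability metric is a metric on a class of probability measures. *)

theory Defs
  imports "HOL-Probability.Probability"
begin

definition prob_moment :: "real \<Rightarrow> 'a::euclidean_space measure set" where
  "prob_moment \<alpha> =
     {\<mu>. prob_space \<mu> \<and> sets \<mu> = sets borel \<and> integrable \<mu> (\<lambda>v. norm v powr \<alpha>)}"

definition fourier :: "'a::euclidean_space measure \<Rightarrow> 'a \<Rightarrow> complex" where
  "fourier \<mu> \<xi> = (LINT v|\<mu>. exp (- \<i> * complex_of_real (\<xi> \<bullet> v)))"

(* The codomain is generic so that the same difference and seminorm apply to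
   complex-valued functions and to their real parts. *)
definition fdiff :: "nat \<Rightarrow> 'a::real_vector \<Rightarrow> ('a \<Rightarrow> 'b::real_normed_field) \<Rightarrow> 'b" where
  "fdiff k \<xi> \<phi> =
     (\<Sum>m=0..k. of_nat (k choose m) * (-1) ^ (k - m) * \<phi> (real m *\<^sub>R \<xi>))"

(* Suprema and integrals that may diverge are taken in ennreal: infinite values
   are not collapsed to a junk real value. *)
definition diff_norm ::
    "real \<Rightarrow> nat \<Rightarrow> ('a::euclidean_space \<Rightarrow> 'b::real_normed_field) \<Rightarrow> ennreal" where
  "diff_norm \<alpha> k \<phi> =
     (\<integral>\<^sup>+ \<xi>. ennreal (norm (fdiff k \<xi> \<phi>) / norm \<xi> powr (real DIM('a) + \<alpha>)) \<partial>lborel)"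

definition fourier_dist ::
    "real \<Rightarrow> 'a::euclidean_space measure \<Rightarrow> 'a measure \<Rightarrow> ennreal" where
  "fourier_dist \<beta> \<mu> \<nu> =
     (SUP \<xi>\<in>- {0}. ennreal (norm (fourier \<mu> \<xi> - fourier \<nu> \<xi>) / norm \<xi> powr \<beta>))"

definition F_dist ::
    "nat \<Rightarrow> real \<Rightarrow> real \<Rightarrow> 'a::euclidean_space measure \<Rightarrow> 'a measure \<Rightarrow> ennreal" where
  "F_dist k \<alpha> \<beta> \<mu> \<nu> =
     fourier_dist \<beta> \<mu> \<nu> + diff_norm \<alpha> k (\<lambda>\<xi>. fourier \<mu> \<xi> - fourier \<nu> \<xi>)"

definition H_dist ::
    "nat \<Rightarrow> real \<Rightarrow> real \<Rightarrow> 'a::euclidean_space measure \<Rightarrow> 'a measure \<Rightarrow> ennreal" where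
  "H_dist k \<alpha> \<beta> \<mu> \<nu> =
     fourier_dist \<beta> \<mu> \<nu> + diff_norm \<alpha> k (\<lambda>\<xi>. Re (fourier \<mu> \<xi>) - Re (fourier \<nu> \<xi>))"

(* Finiteness on S is part of the claim, so that enn2real loses no information there. *)
definition complete_metric_on :: "'s set \<Rightarrow> ('s \<Rightarrow> 's \<Rightarrow> ennreal) \<Rightarrow> bool" where
  "complete_metric_on S D \<longleftrightarrow>
     (\<forall>x\<in>S. \<forall>y\<in>S. D x y < \<infinity>) \<and>
     Metric_space S (\<lambda>x y. enn2real (D x y)) \<and>
     Metric_space.mcomplete S (\<lambda>x y. enn2real (D x y))"

end

theory Submission
  imports Defs
begin

text \<open>
  The classes \<open>\<P>\<^sub>\<alpha>\<close> carry both metrics because of one identity.  Integrating against the weight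
  \<open>\<bar>\<xi>\<bar> powr (- d - \<alpha>)\<close>, which is homogeneous, turns the difference \<open>(exp (- \<i> \<xi> \<bullet> v) - 1) ^ k\<close> into a
  multiple of \<open>\<bar>v\<bar> powr \<alpha>\<close>.  For the absolute value this is only an upper bound, and it makes the
  seminorms finite.  For the real part it is two-sided (\<open>integral_Re_diff_kernel\<close>,
  \<open>integral_cos_rem_lower\<close>): since the \<open>k\<close>-th difference kills polynomials of degree below \<open>k\<close>, the cosines
  in the real part may be replaced by their Taylor remainders, which have a constant sign, and
  homogeneity then pulls out the factor \<open>\<Sum>m\<le>k. (k choose m) * (-1) ^ (k - m) * m powr \<alpha>\<close>.  By the mean
  value theorem this \<open>k\<close>-th difference of a power vanishes only for the integers
  \<open>\<alpha> < k\<close> (\<open>forward_diff_powr_nonzero\<close>).  The hypotheses on \<open>\<alpha>\<close> ensure that the kernel is integrable, that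
  this factor is nonzero, and that there is a Taylor order \<open>p\<close> with \<open>2 p - 2 < \<alpha> < 2 p\<close>.

  Hence, on \<open>\<P>\<^sub>\<alpha>\<close>, the moment of order \<open>\<alpha>\<close> is controlled by the distance to a fixed measure
  (\<open>moment_bound\<close>), and the moments of a Cauchy sequence are bounded.  This uses the
  moments of the members of the sequence only through the identity above, so nothing has to be known
  about the limit beforehand.  Bounded moments give tightness, so a subsequence converges weakly
  (\<open>tight_imp_weakly_convergent_subsequence\<close>), its limit has a finite moment of order \<open>\<alpha>\<close>, and the Fourier
  transforms converge pointwise along the subsequence.  Both parts of the metric are lower
  semicontinuous under pointwise convergence, by definition of the supremum and by Fatou's lemma, so
  the Cauchy sequence converges to this limit in the metric.

  Two facts in dimension \<open>d\<close> are reduced to dimension one.  Weak compactness is transported from the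
  line by a space-filling curve with a measurable section.  Uniqueness of the Fourier transform is
  obtained one coordinate at a time.

  Both metrics are treated together: they are the cases \<open>L = (\<lambda>z. z)\<close> and \<open>L = Re\<close> of one metric in which the
  differences are observed through a contraction \<open>L\<close> that does not lose the real part.
\<close>

section \<open>Iterated differences of powers\<close>

definition forward_diff :: "nat \<Rightarrow> (real \<Rightarrow> real) \<Rightarrow> real \<Rightarrow> real" where
  "forward_diff k f x = (\<Sum>m\<le>k. of_nat (k choose m) * (-1) ^ (k - m) * f (x + real m))"

lemma forward_diff_0 [simp]: "forward_diff 0 f x = f x"
  by (simp add: forward_diff_def)

lemma binomial_alternating_sum_Suc:
  fixes h :: "nat \<Rightarrow> real"
  shows "(\<Sum>m\<le>Suc k. real (Suc k choose m) * (-1) ^ (Suc k - m) * h m) =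
    (\<Sum>m\<le>k. real (k choose m) * (-1) ^ (k - m) * h (Suc m)) - (\<Sum>m\<le>k. real (k choose m) * (-1) ^ (k - m) * h m)"
proof -
  let ?r = "(-1) ^ Suc k * h 0 + (\<Sum>m\<le>k. real (k choose Suc m) * (-1) ^ (k - m) * h (Suc m))"
  have "(\<Sum>m\<le>Suc k. real (Suc k choose m) * (-1) ^ (Suc k - m) * h m) =
      (-1) ^ Suc k * h 0 + (\<Sum>m\<le>k. real (Suc k choose Suc m) * (-1) ^ (k - m) * h (Suc m))"
    unfolding sum.atMost_Suc_shift by simp
  also have "(\<Sum>m\<le>k. real (Suc k choose Suc m) * (-1) ^ (k - m) * h (Suc m)) =
      (\<Sum>m\<le>k. real (k choose m) * (-1) ^ (k - m) * h (Suc m)) + (\<Sum>m\<le>k. real (k choose Suc m) * (-1) ^ (k - m) * h (Suc m))"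
    unfolding sum.distrib[symmetric] by (rule sum.cong) (simp_all add: distrib_right)
  finally have 1: "(\<Sum>m\<le>Suc k. real (Suc k choose m) * (-1) ^ (Suc k - m) * h m) =
      (\<Sum>m\<le>k. real (k choose m) * (-1) ^ (k - m) * h (Suc m)) + ?r"
    by linarith
  have "- (\<Sum>m\<le>k. real (k choose m) * (-1) ^ (k - m) * h m) =
      (\<Sum>m\<le>k. real (k choose m) * (-1) ^ (Suc k - m) * h m)"
    unfolding sum_negf[symmetric] by (rule sum.cong) (auto simp: Suc_diff_le)
  also have "\<dots> = (\<Sum>m\<le>Suc k. real (k choose m) * (-1) ^ (Suc k - m) * h m)"
    by simp
  also have "\<dots> = ?r"
    unfolding sum.atMost_Suc_shift by simp
  finally show ?thesis using 1 by linarith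
qed

lemma forward_diff_Suc: "forward_diff (Suc k) f x = forward_diff k f (x + 1) - forward_diff k f x"
proof -
  have *: "x + 1 + real m = x + real (Suc m)" for m by simp
  show ?thesis
    unfolding forward_diff_def * by (rule binomial_alternating_sum_Suc[of k "\<lambda>m. f (x + real m)"])
qed

lemma forward_diff_has_derivative:
  assumes "\<And>m. m \<le> k \<Longrightarrow> (f has_real_derivative f' (x + real m)) (at (x + real m))"
  shows "(forward_diff k f has_real_derivative forward_diff k f' x) (at x)"
  unfolding forward_diff_def
  using assms by (intro DERIV_sum DERIV_cmult) (simp add: DERIV_shift[symmetric])

text \<open>  A difference in \<open>x\<close> is a derivative at an intermediate point, and differentiation lowers the exponent
  while it produces the factor \<open>a\<close>.  After \<open>k\<close> steps the result is
  \<open>a * (a - 1) * \<dots> * (a - k + 1)\<close> times a power of a positive number.  The case \<open>x = 0\<close> is the one of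
  interest; it only occurs before the first step, where continuity at \<open>0\<close> suffices.\<close>

lemma forward_diff_powr_nonzero:
  assumes "\<And>j. j < k \<Longrightarrow> a \<noteq> real j" "0 < x \<or> (x = 0 \<and> 0 < a)" "0 < k \<or> 0 < x"
  shows "forward_diff k (\<lambda>t. t powr a) x \<noteq> 0"
  using assms
proof (induction k arbitrary: a x)
  case 0
  then show ?case by simp
next
  case (Suc k)
  have der: "(forward_diff k (\<lambda>t. t powr a) has_real_derivative a * forward_diff k (\<lambda>t. t powr (a-1)) y) (at y)"
    if "y > 0" for y
  proof -
    have "(forward_diff k (\<lambda>t. t powr a) has_real_derivative forward_diff k (\<lambda>t. a * t powr (a-1)) y) (at y)"
      using that by (intro forward_diff_has_derivative) (auto intro!: derivative_eq_intros)
    also have "forward_diff k (\<lambda>t. a * t powr (a-1)) y = a * forward_diff k (\<lambda>t. t powr (a-1)) y"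
      by (simp add: forward_diff_def sum_distrib_left mult_ac)
    finally show ?thesis .
  qed
  have cont: "continuous_on {x..x+1} (forward_diff k (\<lambda>t. t powr a))"
    unfolding forward_diff_def using Suc.prems(2)
    by (intro continuous_intros continuous_on_powr') auto
  obtain y where y: "x < y" "y < x + 1"
    "forward_diff k (\<lambda>t. t powr a) (x+1) - forward_diff k (\<lambda>t. t powr a) x = (x + 1 - x) * (a * forward_diff k (\<lambda>t. t powr (a-1)) y)"
  proof -
    obtain l z where lz: "x < z" "z < x+1" "DERIV (forward_diff k (\<lambda>t. t powr a)) z :> l"
        "forward_diff k (\<lambda>t. t powr a) (x+1) - forward_diff k (\<lambda>t. t powr a) x = (x + 1 - x) * l"
    proof (rule exE[OF MVT[of x "x+1" "forward_diff k (\<lambda>t. t powr a)"]])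
      show "forward_diff k (\<lambda>t. t powr a) differentiable (at z)" if "x < z" "z < x + 1" for z
        using that Suc.prems(2) der[of z] by (auto simp: real_differentiable_def)
    qed (use cont in auto)
    then have "l = a * forward_diff k (\<lambda>t. t powr (a-1)) z"
      using DERIV_unique der Suc.prems(2) by (metis less_trans)
    then show ?thesis using that lz by blast
  qed
  have "a - 1 \<noteq> real j" if "j < k" for j
    using Suc.prems(1)[of "Suc j"] that by auto
  moreover have "0 < y" using y Suc.prems by auto
  ultimately have "forward_diff k (\<lambda>t. t powr (a-1)) y \<noteq> 0"
    by (intro Suc.IH) auto
  moreover have "a \<noteq> 0" using Suc.prems(1)[of 0] by simp
  ultimately show ?case using y by (simp add: forward_diff_Suc)
qed

text \<open>  By induction the difference of order \<open>k\<close> of a power of degree at most \<open>k\<close> has derivative \<open>0\<close>, so it is constant and the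
  next difference vanishes.\<close>

lemma forward_diff_power_eq_0:
  assumes "j < k" shows "forward_diff k (\<lambda>t. t ^ j) x = 0"
  using assms
proof (induction k arbitrary: j x)
  case (Suc k)
  have der: "(forward_diff k (\<lambda>t. t ^ j) has_real_derivative 0) (at y)" for y
  proof -
    have "(forward_diff k (\<lambda>t. t ^ j) has_real_derivative forward_diff k (\<lambda>t. real j * t ^ (j-1)) y) (at y)"
      by (intro forward_diff_has_derivative) (auto intro!: derivative_eq_intros)
    also have "forward_diff k (\<lambda>t. real j * t ^ (j-1)) y = real j * forward_diff k (\<lambda>t. t ^ (j-1)) y"
      by (simp add: forward_diff_def sum_distrib_left mult_ac)
    also have "\<dots> = 0"
      using Suc.IH[of "j-1" y] Suc.prems by (cases j) auto
    finally show ?thesis .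
  qed
  have "forward_diff k (\<lambda>t. t ^ j) (x+1) = forward_diff k (\<lambda>t. t ^ j) x"
    using DERIV_const_ratio_const[of "x+1" x] DERIV_isconst_all der by blast
  then show ?case by (simp add: forward_diff_Suc)
qed simp

section \<open>Taylor remainders of the cosine\<close>

definition cos_rem :: "nat \<Rightarrow> real \<Rightarrow> real" where
  "cos_rem p s = cos s - (\<Sum>m<2*p. cos_coeff m * s ^ m)"

lemma cos_rem_bound: "\<bar>cos_rem p s\<bar> \<le> \<bar>s\<bar> ^ (2*p) / fact (2*p)"
proof -
  obtain t where "cos s = (\<Sum>m<2*p. cos_coeff m * s ^ m) + (cos (t + 1/2 * real (2*p) * pi) / fact (2*p)) * s ^ (2*p)"
    using Maclaurin_cos_expansion[of s "2*p"] by blast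
  then have "cos_rem p s = (cos (t + 1/2 * real (2*p) * pi) / fact (2*p)) * s ^ (2*p)"
    by (simp add: cos_rem_def)
  then have "\<bar>cos_rem p s\<bar> = \<bar>cos (t + 1/2 * real (2*p) * pi)\<bar> * (\<bar>s\<bar> ^ (2*p) / fact (2*p))"
    by (simp add: abs_mult power_abs)
  also have "\<dots> \<le> 1 * (\<bar>s\<bar> ^ (2*p) / fact (2*p))"
    by (intro mult_right_mono) auto
  finally show ?thesis by simp
qed

lemma cos_rem_Suc: "cos_rem (Suc p) s = cos_rem p s - (-1) ^ p * (s ^ (2*p) / fact (2*p))"
  by (simp add: cos_rem_def cos_coeff_def)

text \<open>  Passing from one order to the next subtracts the next Taylor term, and by the bound above the
  remainder is at most as large as that term.\<close>

lemma cos_rem_sign: "0 \<le> (-1) ^ Suc p * cos_rem (Suc p) s"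
proof -
  have "(-1) ^ p * cos_rem p s \<le> \<bar>cos_rem p s\<bar>"
    by (cases "even p") auto
  also have "\<dots> \<le> s ^ (2*p) / fact (2*p)"
    using cos_rem_bound[of p s] by (simp add: power_abs[symmetric] power_mult)
  finally have "(-1) ^ p * cos_rem p s \<le> s ^ (2*p) / fact (2*p)" .
  then show ?thesis
    by (cases "even p") (auto simp: cos_rem_Suc)
qed

lemma cos_rem_lower:
  assumes "\<bar>s\<bar> \<le> 1"
  shows "s ^ (2*p) / (2 * fact (2*p)) \<le> (-1) ^ p * cos_rem p s"
proof -
  have pos: "0 \<le> s ^ (2*p)" by (simp add: power_mult)
  have 1: "(fact (2 * Suc p) :: real) = (2 * p + 1) * (2 * p + 2) * fact (2*p)"
    by (simp add: algebra_simps)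
  have "(-1) ^ Suc p * cos_rem (Suc p) s \<le> \<bar>cos_rem (Suc p) s\<bar>"
    by (cases "even p") auto
  also have "\<dots> \<le> s ^ (2 * Suc p) / fact (2 * Suc p)"
    using cos_rem_bound[of "Suc p" s] by (simp add: power_abs[symmetric] power_mult del: fact_Suc)
  also have "\<dots> \<le> s ^ (2*p) / (2 * fact (2*p))"
  proof (rule frac_le)
    show "s ^ (2 * Suc p) \<le> s ^ (2*p)"
      using assms pos by (simp add: power2_eq_square[symmetric] abs_square_le_1 mult_left_le_one_le
         flip: mult.assoc)
    have "(2::real) \<le> (2 * p + 1) * (2 * p + 2)"
      by (simp add: algebra_simps)
    then have "2 * fact (2*p) \<le> ((2 * p + 1) * (2 * p + 2)) * (fact (2*p) :: real)"
      by (intro mult_right_mono) auto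
    then show "2 * fact (2*p) \<le> (fact (2 * Suc p) :: real)"
      using 1 by simp
  qed (use pos in auto)
  finally have "(-1) ^ Suc p * cos_rem (Suc p) s \<le> s ^ (2*p) / (2 * fact (2*p))" .
  then show ?thesis
    by (cases "even p") (auto simp: cos_rem_Suc)
qed

text \<open>  The exponent \<open>2 p\<close> gives integrability against \<open>\<bar>s\<bar> powr (- 1 - \<alpha>)\<close> near \<open>0\<close>, and \<open>2 p - 2\<close> gives it near
  infinity, when \<open>2 p - 2 < \<alpha> < 2 p\<close>.\<close>

lemma cos_rem_growth:
  assumes "0 < p"
  shows "\<bar>cos_rem p s\<bar> \<le> 2 * min (\<bar>s\<bar> ^ (2*p)) (\<bar>s\<bar> ^ (2*p - 2))"
proof -
  obtain q where q: "p = Suc q" using assms by (cases p) auto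
  have f: "x / fact n \<le> x" if "0 \<le> x" for x :: real and n :: nat
    using that fact_ge_1[of n, where 'a=real] by (simp add: divide_le_eq mult_le_cancel_left1)
  have "\<bar>cos_rem p s\<bar> \<le> 2 * \<bar>s\<bar> ^ (2*p)"
    using order.trans[OF cos_rem_bound[of p s] f[of "\<bar>s\<bar> ^ (2*p)" "2*p"]]
      zero_le_power_abs[of s "2*p"] by linarith
  moreover have "\<bar>cos_rem p s\<bar> \<le> 2 * \<bar>s\<bar> ^ (2*q)"
  proof -
    have "\<bar>cos_rem p s\<bar> \<le> \<bar>cos_rem q s\<bar> + \<bar>s\<bar> ^ (2*q) / fact (2*q)"
      unfolding q cos_rem_Suc by (rule order.trans[OF abs_triangle_ineq4]) (simp add: abs_mult power_abs)
    moreover have "\<bar>s\<bar> ^ (2*q) / fact (2*q) \<le> \<bar>s\<bar> ^ (2*q)"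
      by (rule f) simp
    ultimately show ?thesis
      using cos_rem_bound[of q s] by linarith
  qed
  ultimately show ?thesis
    by (auto simp: q min_def)
qed

text \<open>  Only even powers are subtracted from the cosine, and their degrees are at most \<open>2 p - 2 < k\<close>, so their
  \<open>k\<close>-th differences vanish.\<close>

lemma binomial_cos_eq_cos_rem:
  assumes "2 * p \<le> Suc k"
  shows "(\<Sum>m\<le>k. of_nat (k choose m) * (-1) ^ (k - m) * cos (real m * s)) =
         (\<Sum>m\<le>k. of_nat (k choose m) * (-1) ^ (k - m) * cos_rem p (real m * s))"
proof -
  have z: "cos_coeff j * s ^ j * forward_diff k (\<lambda>t. t ^ j) 0 = 0" if "j < 2 * p" for j
  proof (cases "even j")
    case True
    with that assms have "j < k" by (auto elim!: evenE)
    then show ?thesis by (simp add: forward_diff_power_eq_0)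
  qed (simp add: cos_coeff_def)
  have "(\<Sum>m\<le>k. of_nat (k choose m) * (-1) ^ (k - m) * (\<Sum>j<2*p. cos_coeff j * (real m * s) ^ j))
     = (\<Sum>j<2*p. cos_coeff j * s ^ j * forward_diff k (\<lambda>t. t ^ j) 0)"
    unfolding forward_diff_def sum_distrib_left
    by (subst sum.swap) (simp add: power_mult_distrib mult_ac)
  also have "\<dots> = 0" by (intro sum.neutral ballI z) simp
  finally show ?thesis
    by (simp add: cos_rem_def right_diff_distrib sum_subtractf)
qed

section \<open>The homogeneous weight\<close>

text \<open>  The weight of \<open>diff_norm\<close>, as a measure: \<open>diff_norm\<close> is an \<open>L\<^sup>1\<close> norm with respect to it.  At the origin the
  density is \<open>0\<close>, by the convention for division by zero.\<close>

definition riesz :: "real \<Rightarrow> 'a::euclidean_space measure" where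
  "riesz \<alpha> = density lborel (\<lambda>\<xi>. ennreal (1 / norm \<xi> powr (real DIM('a) + \<alpha>)))"

lemma sets_riesz [simp, measurable_cong]: "sets (riesz \<alpha>) = sets borel"
  and space_riesz [simp]: "space (riesz \<alpha>) = UNIV"
  by (simp_all add: riesz_def)

lemma nn_integral_riesz:
  fixes f :: "'a::euclidean_space \<Rightarrow> ennreal"
  assumes [measurable]: "f \<in> borel_measurable borel"
  shows "(\<integral>\<^sup>+\<xi>. f \<xi> \<partial>riesz \<alpha>) = (\<integral>\<^sup>+\<xi>. ennreal (1 / norm \<xi> powr (real DIM('a) + \<alpha>)) * f \<xi> \<partial>lborel)"
  unfolding riesz_def by (subst nn_integral_density) auto

lemma sigma_finite_riesz: "sigma_finite_measure (riesz \<alpha> :: 'a::euclidean_space measure)"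
  unfolding riesz_def by (subst sigma_finite_measure.sigma_finite_iff_density_finite[OF sigma_finite_lborel]) auto

lemma nn_integral_riesz_scale:
  fixes f :: "'a::euclidean_space \<Rightarrow> ennreal"
  assumes [measurable]: "f \<in> borel_measurable borel" and c: "0 < c"
  shows "(\<integral>\<^sup>+\<xi>. f (c *\<^sub>R \<xi>) \<partial>riesz \<alpha>) = ennreal (c powr \<alpha>) * (\<integral>\<^sup>+\<xi>. f \<xi> \<partial>riesz \<alpha>)"
proof -
  define w :: "'a \<Rightarrow> real" where "w \<xi> = 1 / norm \<xi> powr (real DIM('a) + \<alpha>)" for \<xi>
  have [measurable]: "w \<in> borel_measurable borel" unfolding w_def by measurable
  have w: "ennreal (w \<xi>) = ennreal (c powr \<alpha>) * (ennreal (c ^ DIM('a)) * ennreal (w (c *\<^sub>R \<xi>)))" for \<xi>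
    using c by (simp add: w_def powr_mult powr_add powr_realpow ennreal_mult'[symmetric])
  have "(\<integral>\<^sup>+\<xi>. f \<xi> \<partial>riesz \<alpha>) = (\<integral>\<^sup>+\<xi>. ennreal (w \<xi>) * f \<xi> \<partial>lborel)"
    by (subst nn_integral_riesz) (auto simp: w_def)
  also have "\<dots> = (\<integral>\<^sup>+\<xi>. ennreal (c ^ DIM('a)) * (ennreal (w (c *\<^sub>R \<xi>)) * f (c *\<^sub>R \<xi>)) \<partial>lborel)"
    using c by (subst lborel_affine[of c 0]) (auto simp: nn_integral_density nn_integral_distr)
  finally have "ennreal (c powr \<alpha>) * (\<integral>\<^sup>+\<xi>. f \<xi> \<partial>riesz \<alpha>)
     = (\<integral>\<^sup>+\<xi>. ennreal (c powr \<alpha>) * (ennreal (c ^ DIM('a)) * (ennreal (w (c *\<^sub>R \<xi>)) * f (c *\<^sub>R \<xi>))) \<partial>lborel)"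
    by (simp add: nn_integral_cmult)
  also have "\<dots> = (\<integral>\<^sup>+\<xi>. ennreal (w \<xi>) * f (c *\<^sub>R \<xi>) \<partial>lborel)"
    by (subst w) (simp add: mult_ac)
  also have "\<dots> = (\<integral>\<^sup>+\<xi>. f (c *\<^sub>R \<xi>) \<partial>riesz \<alpha>)"
    by (subst nn_integral_riesz) (auto simp: w_def)
  finally show ?thesis ..
qed

text \<open>  Homogeneity of the weight, in the form that transfers to Bochner integrals without any integrability
  assumption.\<close>

lemma distr_riesz_scale:
  assumes c: "0 < c"
  shows "distr (riesz \<alpha>) borel (\<lambda>\<xi>. c *\<^sub>R \<xi>) =
    density (riesz \<alpha> :: 'a::euclidean_space measure) (\<lambda>_. ennreal (c powr \<alpha>))"
proof (rule measure_eqI)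
  fix A :: "'a set" assume "A \<in> sets (distr (riesz \<alpha>) borel (\<lambda>\<xi>. c *\<^sub>R \<xi>))"
  then have [measurable]: "A \<in> sets borel" by simp
  have "emeasure (distr (riesz \<alpha>) borel (\<lambda>\<xi>. c *\<^sub>R \<xi>)) A = (\<integral>\<^sup>+\<xi>. indicator A \<xi> \<partial>distr (riesz \<alpha>) borel (\<lambda>\<xi>. c *\<^sub>R \<xi>))"
    by simp
  also have "\<dots> = (\<integral>\<^sup>+\<xi>. indicator A (c *\<^sub>R \<xi>) \<partial>riesz \<alpha>)"
    by (subst nn_integral_distr) auto
  also have "\<dots> = ennreal (c powr \<alpha>) * (\<integral>\<^sup>+\<xi>. indicator A \<xi> \<partial>riesz \<alpha>)"
    using c by (intro nn_integral_riesz_scale) auto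
  also have "\<dots> = emeasure (density (riesz \<alpha>) (\<lambda>_. ennreal (c powr \<alpha>))) A"
    by (simp add: emeasure_density nn_integral_cmult)
  finally show "emeasure (distr (riesz \<alpha>) borel (\<lambda>\<xi>. c *\<^sub>R \<xi>)) A
    = emeasure (density (riesz \<alpha>) (\<lambda>_. ennreal (c powr \<alpha>))) A" .
qed simp

lemma integral_riesz_scale:
  fixes f :: "'a::euclidean_space \<Rightarrow> real"
  assumes [measurable]: "f \<in> borel_measurable borel" and c: "0 < c"
  shows "(LINT \<xi>|riesz \<alpha>. f (c *\<^sub>R \<xi>)) = c powr \<alpha> * (LINT \<xi>|riesz \<alpha>. f \<xi>)"
proof -
  have "(LINT \<xi>|riesz \<alpha>. f (c *\<^sub>R \<xi>)) = (LINT \<xi>|distr (riesz \<alpha>) borel (\<lambda>\<xi>. c *\<^sub>R \<xi>). f \<xi>)"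
    by (subst integral_distr) auto
  also have "\<dots> = (LINT \<xi>|riesz \<alpha>. c powr \<alpha> * f \<xi>)"
    unfolding distr_riesz_scale[OF c] by (subst integral_density) auto
  finally show ?thesis by simp
qed

lemma riesz_annulus:
  assumes c: "0 < c"
  shows "emeasure (riesz \<alpha> :: 'a::euclidean_space measure) {\<xi>. c / 2 \<le> norm \<xi> \<and> norm \<xi> < c} =
    ennreal (c powr - \<alpha>) * emeasure (riesz \<alpha> :: 'a measure) {\<xi>. 1 / 2 \<le> norm \<xi> \<and> norm \<xi> < 1}"
proof -
  let ?A = "\<lambda>c. {\<xi>::'a. c / 2 \<le> norm \<xi> \<and> norm \<xi> < c}"
  have [measurable]: "?A c \<in> sets borel" for c by measurable
  have "emeasure (riesz \<alpha>) (?A 1) = (\<integral>\<^sup>+\<xi>. indicator (?A 1) \<xi> \<partial>riesz \<alpha>)"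
    by (rule nn_integral_indicator[symmetric]) (simp only: sets_riesz, measurable)
  also have "\<dots> = (\<integral>\<^sup>+\<xi>. indicator (?A c) (c *\<^sub>R \<xi>) \<partial>riesz \<alpha>)"
    using c by (intro nn_integral_cong) (auto simp: indicator_def)
  also have "\<dots> = ennreal (c powr \<alpha>) * emeasure (riesz \<alpha>) (?A c)"
    using c by (subst nn_integral_riesz_scale) auto
  finally have "ennreal (c powr -\<alpha>) * emeasure (riesz \<alpha>) (?A 1)
    = (ennreal (c powr -\<alpha>) * ennreal (c powr \<alpha>)) * emeasure (riesz \<alpha>) (?A c)"
    by (simp add: mult.assoc)
  also have "ennreal (c powr -\<alpha>) * ennreal (c powr \<alpha>) = 1"
    using c by (simp add: ennreal_mult'[symmetric] powr_add[symmetric])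
  finally show ?thesis by simp
qed

lemma riesz_unit_annulus_finite:
  assumes "0 < \<alpha>"
  shows "emeasure (riesz \<alpha> :: 'a::euclidean_space measure) {\<xi>. 1 / 2 \<le> norm \<xi> \<and> norm \<xi> < 1} < \<infinity>"
proof -
  let ?A = "{\<xi>::'a. 1 / 2 \<le> norm \<xi> \<and> norm \<xi> < 1}" and ?p = "real DIM('a) + \<alpha>"
  have "emeasure (riesz \<alpha>) ?A = (\<integral>\<^sup>+\<xi>. ennreal (1 / norm \<xi> powr ?p) * indicator ?A \<xi> \<partial>lborel)"
    unfolding riesz_def by (rule emeasure_density) auto
  also have "\<dots> \<le> (\<integral>\<^sup>+\<xi>. ennreal (1 / (1/2) powr ?p) * indicator (ball 0 1) \<xi> \<partial>(lborel :: 'a measure))"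
  proof (rule nn_integral_mono, goal_cases)
    case (1 \<xi>)
    show ?case
    proof (cases "\<xi> \<in> ?A")
      case True
      then have "(1/2) powr ?p \<le> norm \<xi> powr ?p"
        using assms by (intro powr_mono2) auto
      then show ?thesis using True
        by (auto intro!: ennreal_leI divide_left_mono mult_pos_pos)
    qed auto
  qed
  also have "\<dots> < \<infinity>"
    by (simp add: nn_integral_cmult_indicator emeasure_ball ennreal_mult_less_top)
  finally show ?thesis .
qed

lemma suminf_geometric_powr_finite:
  assumes "0 < s" "K < \<infinity>"
  shows "(\<Sum>j. ennreal (2 powr (- s * real j)) * K) < (\<infinity>::ennreal)"
proof -
  have "(\<lambda>j. (2 powr (-s)) ^ j) = (\<lambda>j. 2 powr (- s * real j))"
    by (simp add: powr_realpow[symmetric] powr_powr)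
  moreover have "summable (\<lambda>j. (2 powr (-s)) ^ j)"
    using assms by (intro summable_geometric) (auto simp: powr_less_one)
  ultimately have "(\<Sum>j. ennreal (2 powr (- s * real j))) < \<infinity>"
    by (subst suminf_ennreal2) auto
  then show ?thesis
    using assms by (simp add: ennreal_mult_less_top)
qed

lemma term_le_suminf_ennreal: "f j \<le> suminf f" for f :: "nat \<Rightarrow> ennreal"
  using sum_le_suminf[of f "{j}"] by simp

text \<open>  On the dyadic annulus of outer radius \<open>2 powr n\<close> the integrand is at most \<open>2 powr (n a)\<close> and at most
  \<open>2 powr (n b)\<close>, and the weight has mass proportional to \<open>2 powr (- n \<alpha>)\<close>.  So both halves of the sum over \<open>n\<close>
  are geometric series.\<close>

lemma riesz_min_powr_finite:
  assumes "0 \<le> b" "b < \<alpha>" "\<alpha> < a"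
  shows "(\<integral>\<^sup>+\<xi>. ennreal (min (norm \<xi> powr a) (norm \<xi> powr b)) \<partial>(riesz \<alpha> :: 'a::euclidean_space measure)) < \<infinity>"
proof -
  define A where "A c = {\<xi>::'a. c / 2 \<le> norm \<xi> \<and> norm \<xi> < c}" for c :: real
  have [measurable]: "A c \<in> sets borel" for c unfolding A_def by measurable
  define K where "K = emeasure (riesz \<alpha>) (A 1)"
  have K: "K < \<infinity>"
    using riesz_unit_annulus_finite[of \<alpha>, where 'a='a] assms by (simp add: K_def A_def)
  have AK: "emeasure (riesz \<alpha>) (A c) = ennreal (c powr -\<alpha>) * K" if "0 < c" for c
    using riesz_annulus[OF that, of \<alpha>, where 'a='a] by (simp add: K_def A_def)
  define u where "u j = (2::real) powr (- real j)" for j :: nat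
  define v where "v j = (2::real) powr (real j + 1)" for j :: nat
  have uv: "0 < u j" "0 < v j" for j by (simp_all add: u_def v_def)
  have bound: "ennreal (min (norm \<xi> powr a) (norm \<xi> powr b)) \<le>
      (\<Sum>j. ennreal (u j powr a) * indicator (A (u j)) \<xi>) + (\<Sum>j. ennreal (v j powr b) * indicator (A (v j)) \<xi>)"
    for \<xi> :: 'a
  proof (cases "\<xi> = 0")
    case False
    define n where "n = \<lfloor>log 2 (norm \<xi>)\<rfloor>"
    have "2 powr (real_of_int n) \<le> norm \<xi>" "norm \<xi> < 2 powr (real_of_int n + 1)"
      using False by (auto simp: n_def powr_le_iff less_powr_iff)
    then have n: "\<xi> \<in> A (2 powr (real_of_int n + 1))"
      by (simp add: A_def powr_add)
    show ?thesis
    proof (cases "n < 0")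
      case True
      define j where "j = nat (- (n + 1))"
      have "\<xi> \<in> A (u j)" using n True by (simp add: j_def u_def add.commute)
      moreover from this have "norm \<xi> powr a \<le> u j powr a"
        using assms by (intro powr_mono2) (auto simp: A_def)
      ultimately have "ennreal (min (norm \<xi> powr a) (norm \<xi> powr b)) \<le> ennreal (u j powr a) * indicator (A (u j)) \<xi>"
        by (auto intro!: ennreal_leI)
      also have "\<dots> \<le> (\<Sum>j. ennreal (u j powr a) * indicator (A (u j)) \<xi>)"
        by (rule term_le_suminf_ennreal[of "\<lambda>j. ennreal (u j powr a) * indicator (A (u j)) \<xi>"])
      also have "\<dots> \<le> \<dots> + (\<Sum>j. ennreal (v j powr b) * indicator (A (v j)) \<xi>)"
        by simp
      finally show ?thesis .
    next
      case False
      define j where "j = nat n"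
      have "\<xi> \<in> A (v j)" using n False by (simp add: j_def v_def)
      moreover from this have "norm \<xi> powr b \<le> v j powr b"
        using assms by (intro powr_mono2) (auto simp: A_def)
      ultimately have "ennreal (min (norm \<xi> powr a) (norm \<xi> powr b)) \<le> ennreal (v j powr b) * indicator (A (v j)) \<xi>"
        by (auto intro!: ennreal_leI)
      also have "\<dots> \<le> (\<Sum>j. ennreal (v j powr b) * indicator (A (v j)) \<xi>)"
        by (rule term_le_suminf_ennreal[of "\<lambda>j. ennreal (v j powr b) * indicator (A (v j)) \<xi>"])
      also have "\<dots> \<le> (\<Sum>j. ennreal (u j powr a) * indicator (A (u j)) \<xi>) + \<dots>"
        by simp
      finally show ?thesis .
    qed
  qed auto
  have eu: "(\<lambda>j. ennreal (u j powr a) * emeasure (riesz \<alpha>) (A (u j))) = (\<lambda>j. ennreal (2 powr (- (a - \<alpha>) * real j)) * K)"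
  proof
    fix j
    have "u j powr a * u j powr -\<alpha> = 2 powr (- (a - \<alpha>) * real j)"
      unfolding u_def powr_powr powr_add[symmetric] by (rule arg_cong[of _ _ "\<lambda>x. 2 powr x"]) (simp add: algebra_simps)
    moreover have "ennreal (u j powr a) * (ennreal (u j powr -\<alpha>) * K) = ennreal (u j powr a * u j powr -\<alpha>) * K"
      by (simp add: ennreal_mult' mult.assoc)
    ultimately show "ennreal (u j powr a) * emeasure (riesz \<alpha>) (A (u j)) = ennreal (2 powr (- (a - \<alpha>) * real j)) * K"
      by (simp only: AK[OF uv(1)])
  qed
  have ev: "(\<lambda>j. ennreal (v j powr b) * emeasure (riesz \<alpha>) (A (v j))) =
      (\<lambda>j. ennreal (2 powr (- (\<alpha> - b) * real j)) * (ennreal (2 powr (b - \<alpha>)) * K))"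
  proof
    fix j
    have "v j powr b * v j powr -\<alpha> = 2 powr (- (\<alpha> - b) * real j) * 2 powr (b - \<alpha>)"
      unfolding v_def powr_powr powr_add[symmetric] by (rule arg_cong[of _ _ "\<lambda>x. 2 powr x"]) (simp add: algebra_simps)
    moreover have "ennreal (v j powr b) * (ennreal (v j powr -\<alpha>) * K) = ennreal (v j powr b * v j powr -\<alpha>) * K"
      by (simp add: ennreal_mult' mult.assoc)
    ultimately show "ennreal (v j powr b) * emeasure (riesz \<alpha>) (A (v j)) =
        ennreal (2 powr (- (\<alpha> - b) * real j)) * (ennreal (2 powr (b - \<alpha>)) * K)"
      by (simp only: AK[OF uv(2)]) (simp add: ennreal_mult' mult.assoc)
  qed
  have "(\<Sum>j. ennreal (u j powr a) * emeasure (riesz \<alpha>) (A (u j))) < \<infinity>"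
    unfolding eu using assms K by (intro suminf_geometric_powr_finite) auto
  moreover have "(\<Sum>j. ennreal (v j powr b) * emeasure (riesz \<alpha>) (A (v j))) < \<infinity>"
    unfolding ev using assms K by (intro suminf_geometric_powr_finite) (auto simp: ennreal_mult_less_top)
  ultimately have fin: "(\<Sum>j. ennreal (u j powr a) * emeasure (riesz \<alpha>) (A (u j))) +
      (\<Sum>j. ennreal (v j powr b) * emeasure (riesz \<alpha>) (A (v j))) < \<infinity>"
    by simp
  have "(\<integral>\<^sup>+\<xi>. ennreal (min (norm \<xi> powr a) (norm \<xi> powr b)) \<partial>(riesz \<alpha> :: 'a measure)) \<le>
     (\<integral>\<^sup>+\<xi>. (\<Sum>j. ennreal (u j powr a) * indicator (A (u j)) \<xi>) + (\<Sum>j. ennreal (v j powr b) * indicator (A (v j)) \<xi>) \<partial>riesz \<alpha>)"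
    by (intro nn_integral_mono bound)
  also have "\<dots> = (\<Sum>j. ennreal (u j powr a) * emeasure (riesz \<alpha>) (A (u j))) + (\<Sum>j. ennreal (v j powr b) * emeasure (riesz \<alpha>) (A (v j)))"
    by (subst nn_integral_add) (auto simp: nn_integral_suminf nn_integral_cmult_indicator)
  also note fin
  finally show ?thesis .
qed

section \<open>Uniqueness of the Fourier transform\<close>

text \<open>  Equality of the Fourier transforms of the signed measures \<open>u d\<mu>\<close> and \<open>u d\<nu>\<close>.  The phase \<open>\<theta>\<close> stands for the
  real and the imaginary part at once and makes the class stable under products with cosines.\<close>

definition trig_equal :: "'a::euclidean_space measure \<Rightarrow> 'a measure \<Rightarrow> ('a \<Rightarrow> real) \<Rightarrow> bool" where
  "trig_equal \<mu> \<nu> u \<longleftrightarrow>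
     (\<forall>\<xi> \<theta>. (LINT v|\<mu>. u v * cos (\<xi> \<bullet> v + \<theta>)) = (LINT v|\<nu>. u v * cos (\<xi> \<bullet> v + \<theta>)))"

lemma integrable_bounded_borel:
  fixes u :: "'a::euclidean_space \<Rightarrow> 'b::{banach, second_countable_topology}"
  assumes "prob_space \<mu>" "sets \<mu> = sets borel" "u \<in> borel_measurable borel" "\<And>v. norm (u v) \<le> B"
  shows "integrable \<mu> u"
proof -
  interpret prob_space \<mu> by fact
  have "u \<in> borel_measurable \<mu>"
    using assms(3) by (simp cong: measurable_cong_sets add: assms(2))
  then show ?thesis
    using assms(4) by (intro integrable_const_bound[of _ B]) auto
qed

lemma trig_equal_one:
  assumes \<mu>: "prob_space \<mu>" "sets \<mu> = sets borel" and \<nu>: "prob_space \<nu>" "sets \<nu> = sets borel"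
    and eq: "\<And>\<xi>. fourier \<mu> \<xi> = fourier \<nu> \<xi>"
  shows "trig_equal \<mu> \<nu> (\<lambda>_. 1)"
proof -
  have *: "(LINT v|M. cos (\<xi> \<bullet> v + \<theta>)) = Re (fourier M \<xi>) * cos \<theta> + Im (fourier M \<xi>) * sin \<theta>"
    if M: "prob_space M" "sets M = sets borel" for M :: "'a measure" and \<xi> \<theta>
  proof -
    have e: "exp (- \<i> * complex_of_real (\<xi> \<bullet> v)) = Complex (cos (\<xi> \<bullet> v)) (- sin (\<xi> \<bullet> v))" for v
      by (simp add: complex_eq_iff Re_exp Im_exp)
    have i: "integrable M (\<lambda>v. exp (- \<i> * complex_of_real (\<xi> \<bullet> v)))"
      using M by (intro integrable_bounded_borel[where B=1]) auto
    have "Re (fourier M \<xi>) = (LINT v|M. cos (\<xi> \<bullet> v))" "Im (fourier M \<xi>) = (LINT v|M. - sin (\<xi> \<bullet> v))"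
      unfolding fourier_def using integral_Re[OF i] integral_Im[OF i] unfolding e by simp_all
    moreover have "integrable M (\<lambda>v. cos (\<xi> \<bullet> v))" "integrable M (\<lambda>v. sin (\<xi> \<bullet> v))"
      using M by (auto intro!: integrable_bounded_borel[where B=1])
    ultimately show ?thesis
      by (simp add: cos_add)
  qed
  show ?thesis
    unfolding trig_equal_def by (simp add: *[OF \<mu>] *[OF \<nu>] eq)
qed

lemma trig_equal_zero: "trig_equal \<mu> \<nu> (\<lambda>_. 0)"
  by (simp add: trig_equal_def)

text \<open>  The density \<open>w v = 2 + u v * cos (\<xi> \<bullet> v + \<theta>)\<close> is positive, so \<open>w d\<mu>\<close> and \<open>w d\<nu>\<close> are, up to normalization,
  probability measures.  By the product formula for cosines, their images under \<open>v \<mapsto> v \<bullet> b\<close> have the same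
  characteristic function, and the one-dimensional uniqueness theorem applies.\<close>

lemma trig_equal_indicator_weighted:
  fixes u :: "'a::euclidean_space \<Rightarrow> real"
  assumes \<mu>: "prob_space \<mu>" "sets \<mu> = sets borel" and \<nu>: "prob_space \<nu>" "sets \<nu> = sets borel"
    and one: "trig_equal \<mu> \<nu> (\<lambda>_. 1)"
    and [measurable]: "u \<in> borel_measurable borel" and u1: "\<And>v. \<bar>u v\<bar> \<le> 1" and u: "trig_equal \<mu> \<nu> u"
    and [measurable]: "A \<in> sets borel"
  shows "(LINT v|\<mu>. indicator A (v \<bullet> b) * (2 + u v * cos (\<xi> \<bullet> v + \<theta>))) =
         (LINT v|\<nu>. indicator A (v \<bullet> b) * (2 + u v * cos (\<xi> \<bullet> v + \<theta>)))"
proof -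
  define w where "w v = 2 + u v * cos (\<xi> \<bullet> v + \<theta>)" for v
  have [measurable]: "w \<in> borel_measurable borel" unfolding w_def by measurable
  have uc: "\<bar>u v * cos t\<bar> \<le> 1" for v t
    using u1[of v] by (simp add: abs_mult mult_le_one)
  have w1: "1 \<le> w v" "w v \<le> 3" for v
    using uc[of v "\<xi> \<bullet> v + \<theta>"] by (auto simp: w_def)
  have w3: "\<bar>w v\<bar> \<le> 3" for v
    using w1(1)[of v] w1(2)[of v] by linarith
  define c where "c = (LINT v|\<mu>. w v)"
  have int: "integrable M f"
    if "M = \<mu> \<or> M = \<nu>" "f \<in> borel_measurable borel" "\<And>v. norm (f v) \<le> 3" for M and f :: "'a \<Rightarrow> 'b::{banach, second_countable_topology}"
    using that \<mu> \<nu> by (auto intro: integrable_bounded_borel)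
  have wcos: "(LINT v|\<mu>. cos (t * (v \<bullet> b) + \<eta>) * w v) = (LINT v|\<nu>. cos (t * (v \<bullet> b) + \<eta>) * w v)" for t \<eta>
  proof -
    have "(LINT v|M. cos (t * (v \<bullet> b) + \<eta>) * w v) =
        2 * (LINT v|M. 1 * cos ((t *\<^sub>R b) \<bullet> v + \<eta>))
        + 1/2 * (LINT v|M. u v * cos ((t *\<^sub>R b + \<xi>) \<bullet> v + (\<eta> + \<theta>)))
        + 1/2 * (LINT v|M. u v * cos ((t *\<^sub>R b - \<xi>) \<bullet> v + (\<eta> - \<theta>)))"
      if M: "M = \<mu> \<or> M = \<nu>" for M
    proof -
      have i: "integrable M (\<lambda>v. 1 * cos ((t *\<^sub>R b) \<bullet> v + \<eta>))"
        "integrable M (\<lambda>v. u v * cos (x \<bullet> v + y))" for x y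
        using uc by (auto intro!: int[OF M] order.trans[OF uc] order.trans[OF abs_cos_le_one])
      have "cos (t * (v \<bullet> b) + \<eta>) * w v = 2 * (1 * cos ((t *\<^sub>R b) \<bullet> v + \<eta>))
        + 1/2 * (u v * cos ((t *\<^sub>R b + \<xi>) \<bullet> v + (\<eta> + \<theta>)))
        + 1/2 * (u v * cos ((t *\<^sub>R b - \<xi>) \<bullet> v + (\<eta> - \<theta>)))" for v
      proof -
        have 1: "(t *\<^sub>R b + \<xi>) \<bullet> v + (\<eta> + \<theta>) = (t * (v \<bullet> b) + \<eta>) + (\<xi> \<bullet> v + \<theta>)"
          "(t *\<^sub>R b - \<xi>) \<bullet> v + (\<eta> - \<theta>) = (t * (v \<bullet> b) + \<eta>) - (\<xi> \<bullet> v + \<theta>)"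
          "(t *\<^sub>R b) \<bullet> v = t * (v \<bullet> b)"
          by (simp_all add: inner_simps inner_commute[of b v])
        show ?thesis
          unfolding w_def 1 cos_add cos_diff by (simp add: algebra_simps)
      qed
      then show ?thesis using i by simp
    qed
    then show ?thesis
      using one u unfolding trig_equal_def by metis
  qed
  have c: "c = (LINT v|\<mu>. w v)" "c = (LINT v|\<nu>. w v)"
    using wcos[of 0 0] by (simp_all add: c_def)
  have c1: "1 \<le> c"
  proof -
    interpret prob_space \<mu> by fact
    have "(LINT v|\<mu>. 1) \<le> c"
      unfolding c_def using w1 w3 by (intro integral_mono int) auto
    then show ?thesis by (simp add: prob_space)
  qed
  have wc: "0 \<le> w v / c" for v
    using w1(1)[of v] c1 by simp
  define D where "D M = distr (density M (\<lambda>v. ennreal (w v / c))) borel (\<lambda>v. v \<bullet> b)" for M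
  have meas: "f \<in> borel_measurable M \<longleftrightarrow> f \<in> borel_measurable borel" if "M = \<mu> \<or> M = \<nu>" for M and f :: "'a \<Rightarrow> 'b::topological_space"
    using that \<mu>(2) \<nu>(2) by (auto cong: measurable_cong_sets)
  have rd: "real_distribution (D M)" if M: "M = \<mu> \<or> M = \<nu>" for M
  proof -
    have "emeasure (density M (\<lambda>v. ennreal (w v / c))) (space M) = (\<integral>\<^sup>+v. ennreal (w v / c) \<partial>M)"
      by (subst emeasure_density) (auto simp: meas[OF M] intro!: nn_integral_cong)
    also have "\<dots> = ennreal (LINT v|M. w v / c)"
      using w1 w3 c1 M by (intro nn_integral_eq_integral integrable_divide int)
        (auto intro!: AE_I2 simp: wc)
    also have "(LINT v|M. w v / c) = 1"
      using c c1 M by auto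
    finally have "prob_space (density M (\<lambda>v. ennreal (w v / c)))"
      by (intro prob_spaceI) simp
    then show ?thesis
      unfolding D_def by (intro prob_space.real_distribution_distr) (auto simp: meas[OF M])
  qed
  have intD: "(LINT x|D M. f x) = (LINT v|M. (w v / c) *\<^sub>R f (v \<bullet> b))"
    if M: "M = \<mu> \<or> M = \<nu>" and [measurable]: "f \<in> borel_measurable borel"
    for M and f :: "real \<Rightarrow> 'b::{banach, second_countable_topology}"
    unfolding D_def using wc
    by (subst integral_distr) (auto simp: meas[OF M] intro!: integral_density)
  have "char (D \<mu>) t = char (D \<nu>) t" for t
  proof -
    have char_D: "char (D M) t = complex_of_real ((LINT v|M. cos (t * (v \<bullet> b) + 0) * w v) / c)
        + \<i> * complex_of_real ((LINT v|M. cos (t * (v \<bullet> b) + - pi/2) * w v) / c)"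
      if M: "M = \<mu> \<or> M = \<nu>" for M
    proof -
      have cw: "\<bar>cos s * w v\<bar> \<le> 3" for s v
        using w1[of v] mult_mono[of "\<bar>cos s\<bar>" 1 "w v" 3] by (simp add: abs_mult)
      have i: "integrable M (\<lambda>v. cos (t * (v \<bullet> b) + \<eta>) * w v)" for \<eta>
        by (intro int[OF M]) (auto simp: cw)
      have "cos (t * y + - pi/2) = sin (t * y)" for y
        using cos_add[of "t * y" "-pi/2"] by (simp add: sin_cos_eq)
      then have e: "(w v / c) *\<^sub>R iexp (t * (v \<bullet> b)) =
          complex_of_real (cos (t * (v \<bullet> b) + 0) * w v / c) + \<i> * complex_of_real (cos (t * (v \<bullet> b) + - pi/2) * w v / c)" for v
        by (simp add: complex_eq_iff Re_exp Im_exp)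
      have i2: "integrable M (\<lambda>v. complex_of_real (cos (t * (v \<bullet> b) + \<eta>) * w v / c))" for \<eta>
        using i by (intro integrable_of_real integrable_divide)
      have "char (D M) t = (LINT v|M. (w v / c) *\<^sub>R iexp (t * (v \<bullet> b)))"
        unfolding char_def by (subst intD[OF M]) auto
      also have "\<dots> = (LINT v|M. complex_of_real (cos (t * (v \<bullet> b) + 0) * w v / c))
          + (LINT v|M. \<i> * complex_of_real (cos (t * (v \<bullet> b) + - pi/2) * w v / c))"
        unfolding e by (intro Bochner_Integration.integral_add integrable_mult_right i2)
      also have "\<dots> = complex_of_real (LINT v|M. cos (t * (v \<bullet> b) + 0) * w v / c)
          + \<i> * complex_of_real (LINT v|M. cos (t * (v \<bullet> b) + - pi/2) * w v / c)"
        by (simp only: integral_mult_right_zero integral_complex_of_real)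
      finally show ?thesis by simp
    qed
    show ?thesis
      by (simp only: char_D[OF disjI1[OF refl]] char_D[OF disjI2[OF refl]] wcos)
  qed
  then have "D \<mu> = D \<nu>"
    using rd by (intro Levy_uniqueness) auto
  then have "(LINT x|D \<mu>. indicator A x :: real) = (LINT x|D \<nu>. indicator A x)" by simp
  then have "(LINT v|\<mu>. (indicator A (v \<bullet> b) * w v) / c) = (LINT v|\<nu>. (indicator A (v \<bullet> b) * w v) / c)"
    by (subst (asm) (1 2) intD) (auto simp: mult.commute)
  then show ?thesis
    using c1 unfolding w_def[symmetric] by simp
qed

text \<open>  Subtracting the case \<open>u = 0\<close> of the preceding lemma removes the constant \<open>2\<close>, which only served to make
  the density positive.\<close>

lemma trig_equal_step:
  fixes u :: "'a::euclidean_space \<Rightarrow> real"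
  assumes \<mu>: "prob_space \<mu>" "sets \<mu> = sets borel" and \<nu>: "prob_space \<nu>" "sets \<nu> = sets borel"
    and one: "trig_equal \<mu> \<nu> (\<lambda>_. 1)"
    and [measurable]: "u \<in> borel_measurable borel" and u1: "\<And>v. \<bar>u v\<bar> \<le> 1" and u: "trig_equal \<mu> \<nu> u"
    and [measurable]: "A \<in> sets borel"
  shows "trig_equal \<mu> \<nu> (\<lambda>v. indicator A (v \<bullet> b) * u v)"
  unfolding trig_equal_def
proof safe
  fix \<xi> \<theta>
  have uc: "\<bar>u v * cos t\<bar> \<le> 1" for v t
    using u1[of v] by (simp add: abs_mult mult_le_one)
  have *: "(LINT v|M. indicator A (v \<bullet> b) * u v * cos (\<xi> \<bullet> v + \<theta>)) =
      (LINT v|M. indicator A (v \<bullet> b) * (2 + u v * cos (\<xi> \<bullet> v + \<theta>)))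
    - (LINT v|M. indicator A (v \<bullet> b) * (2 + 0 * cos (\<xi> \<bullet> v + \<theta>)))" if "M = \<mu> \<or> M = \<nu>" for M
  proof -
    have b: "norm (indicator A s * x) \<le> B" if "\<bar>x\<bar> \<le> B" for s x B :: real
      using that by (auto simp: indicator_def)
    have c: "\<bar>2 + u v * cos t\<bar> \<le> 3" for v t
      using uc[of v t] by auto
    have "integrable M (\<lambda>v. indicator A (v \<bullet> b) * (2 + u v * cos (\<xi> \<bullet> v + \<theta>)))"
      using that \<mu> \<nu> by (auto intro!: integrable_bounded_borel[where B=3] b c simp del: real_norm_def)
    moreover have "integrable M (\<lambda>v. indicator A (v \<bullet> b) * (2 + 0 * cos (\<xi> \<bullet> v + \<theta>)))"
      using that \<mu> \<nu> by (auto intro!: integrable_bounded_borel[where B=3] simp: indicator_def)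
    ultimately show ?thesis
      by (subst Bochner_Integration.integral_diff[symmetric])
        (auto intro!: Bochner_Integration.integral_cong simp: algebra_simps)
  qed
  show "(LINT v|\<mu>. indicator A (v \<bullet> b) * u v * cos (\<xi> \<bullet> v + \<theta>)) = (LINT v|\<nu>. indicator A (v \<bullet> b) * u v * cos (\<xi> \<bullet> v + \<theta>))"
    using trig_equal_indicator_weighted[OF \<mu> \<nu> one _ u1 u, of A b \<xi> \<theta>]
      trig_equal_indicator_weighted[OF \<mu> \<nu> one, of "\<lambda>_. 0" A b \<xi> \<theta>] trig_equal_zero[of \<mu> \<nu>]
    by (simp add: *)
qed

text \<open>  Starting from \<open>u = 1\<close>, one step for each coordinate produces the indicator of a box.\<close>

lemma fourier_unique:
  fixes \<mu> \<nu> :: "'a::euclidean_space measure"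
  assumes \<mu>: "prob_space \<mu>" "sets \<mu> = sets borel" and \<nu>: "prob_space \<nu>" "sets \<nu> = sets borel"
    and eq: "\<And>\<xi>. fourier \<mu> \<xi> = fourier \<nu> \<xi>"
  shows "\<mu> = \<nu>"
proof -
  interpret m: prob_space \<mu> by fact
  interpret n: prob_space \<nu> by fact
  note one = trig_equal_one[OF assms]
  have prod: "trig_equal \<mu> \<nu> (\<lambda>v. \<Prod>b\<in>B. indicator (A b) (v \<bullet> b))"
    if "finite B" "\<And>b. A b \<in> sets borel" for B and A :: "'a \<Rightarrow> real set"
    using that(1)
  proof (induction B rule: finite_induct)
    case empty
    then show ?case using one by simp
  next
    case (insert b B)
    note that(2)[measurable]
    have "\<bar>\<Prod>b\<in>B. indicator (A b) (v \<bullet> b) :: real\<bar> \<le> 1" for v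
      unfolding abs_prod by (intro prod_le_1) (auto simp: indicator_def)
    then show ?case
      using insert trig_equal_step[OF \<mu> \<nu> one _ _ insert.IH, of "A b" b] by simp
  qed
  have box: "emeasure \<mu> (box l u) = emeasure \<nu> (box l u)" for l u
  proof -
    have ind: "(\<Prod>b\<in>Basis. indicator {l \<bullet> b<..<u \<bullet> b} (v \<bullet> b)) = (indicator (box l u) v :: real)" for v
      by (auto simp: box_def indicator_def prod_eq_1_iff intro!: prod.neutral)
    have "trig_equal \<mu> \<nu> (\<lambda>v. indicator (box l u) v)"
      using prod[of Basis "\<lambda>b. {l \<bullet> b<..<u \<bullet> b}"] unfolding ind by simp
    then have "(LINT v|\<mu>. indicator (box l u) v * cos (0 \<bullet> v + 0)) = (LINT v|\<nu>. indicator (box l u) v * cos (0 \<bullet> v + 0))"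
      unfolding trig_equal_def by blast
    then have "measure \<mu> (box l u) = measure \<nu> (box l u)"
      using \<mu>(2) \<nu>(2) sets_eq_imp_space_eq[OF \<mu>(2)] sets_eq_imp_space_eq[OF \<nu>(2)] by simp
    then show ?thesis
      by (simp add: m.emeasure_eq_measure n.emeasure_eq_measure)
  qed
  show ?thesis
  proof (rule measure_eqI_generator_eq)
    let ?E = "range (\<lambda>(a, b). box a b::'a set)"
    show "Int_stable ?E"
      by (auto simp: Int_stable_def box_Int_box)
    show "?E \<subseteq> Pow UNIV" "sets \<mu> = sigma_sets UNIV ?E" "sets \<nu> = sigma_sets UNIV ?E"
      by (simp_all add: borel_eq_box \<mu> \<nu>)
    let ?A = "\<lambda>n::nat. box (- (real n *\<^sub>R One)) (real n *\<^sub>R One) :: 'a set"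
    show "range ?A \<subseteq> ?E" "(\<Union>i. ?A i) = UNIV"
      unfolding UN_box_eq_UNIV by auto
    show "emeasure \<mu> (?A i) \<noteq> \<infinity>" for i by simp
    show "emeasure \<mu> X = emeasure \<nu> X" if "X \<in> ?E" for X
      using that box by auto
  qed
qed

section \<open>A space-filling curve with a measurable section\<close>

text \<open>  A continuous function that reads a digit: it is \<open>0\<close> on \<open>[0, 1/3]\<close> and \<open>1\<close> on \<open>[2/3, 1]\<close>, and has period \<open>2\<close>.  Applied to
  \<open>3 ^ j * t\<close> it recovers the digit \<open>j\<close> of a number \<open>t\<close> of the Cantor set.  This is the building block of
  Schoenberg's curve.\<close>

definition ternary_digit :: "real \<Rightarrow> real" where
  "ternary_digit t = max 0 (min 1 (1/2 - cos (pi * t)))"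

lemma ternary_digit_bounds: "0 \<le> ternary_digit t" "ternary_digit t \<le> 1"
  by (auto simp: ternary_digit_def)

lemma summable_ternary: "summable (\<lambda>i. of_bool (B i) * (c / 3 ^ i) :: real)"
proof (rule summable_comparison_test')
  show "summable (\<lambda>i. \<bar>c\<bar> * (1/3) ^ i)"
    by (intro summable_mult summable_geometric) auto
  show "norm (of_bool (B i) * (c / 3 ^ i) :: real) \<le> \<bar>c\<bar> * (1/3) ^ i" for i
    by (auto simp: power_one_over)
qed

lemma ternary_bounds:
  assumes "0 \<le> c"
  shows "0 \<le> (\<Sum>i. of_bool (B i) * (c / 3 ^ i) :: real)"
    "(\<Sum>i. of_bool (B i) * (c / 3 ^ i) :: real) \<le> c * (3 / 2)"
proof -
  show "0 \<le> (\<Sum>i. of_bool (B i) * (c / 3 ^ i) :: real)"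
    by (intro suminf_nonneg summable_ternary) (use assms in auto)
  have "(\<Sum>i. of_bool (B i) * (c / 3 ^ i) :: real) \<le> (\<Sum>i. c * (1/3) ^ i)"
    using assms by (intro suminf_le summable_ternary summable_mult summable_geometric)
      (auto simp: power_one_over)
  also have "\<dots> = c * (3 / 2)"
    by (subst suminf_mult) (auto simp: suminf_geometric)
  finally show "(\<Sum>i. of_bool (B i) * (c / 3 ^ i) :: real) \<le> c * (3 / 2)" .
qed

text \<open>  In \<open>3 ^ j * t\<close> the digits before \<open>j\<close> contribute an even integer, since all ternary digits are \<open>0\<close> or \<open>2\<close>, and the
  digits after \<open>j\<close> contribute at most \<open>1/3\<close>.  The shift by \<open>2 * N\<close> is invisible because of the period; it leaves room
  for countably many copies of the Cantor set on the line.\<close>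

lemma ternary_digit_eq:
  fixes B :: "nat \<Rightarrow> bool" and N :: nat
  assumes t: "t = 2 * real N + (\<Sum>i. of_bool (B i) * ((2/3) / 3 ^ i))"
  shows "ternary_digit (3 ^ j * t) = of_bool (B j)"
proof -
  define T where "T i = (of_bool (B i) * ((2/3) / 3 ^ i) :: real)" for i
  have sT: "summable T" unfolding T_def by (rule summable_ternary)
  define r where "r = (\<Sum>i. of_bool (B (i + Suc j)) * ((2/9) / 3 ^ i) :: real)"
  have r: "0 \<le> r" "r \<le> 1/3"
    using ternary_bounds[of "2/9" "\<lambda>i. B (i + Suc j)"] by (auto simp: r_def)
  have tail: "3 ^ j * (\<Sum>i. T (i + Suc j)) = r"
    unfolding r_def using sT
    by (subst suminf_mult[symmetric]) (auto simp: T_def power_add field_simps summable_iff_shift[of T "Suc j", symmetric] intro!: suminf_cong)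
  define M where "M = (\<Sum>i<j. of_bool (B i) * 3 ^ (j - Suc i) :: nat)"
  have head: "3 ^ j * (\<Sum>i<j. T i) = 2 * real M"
  proof -
    have "3 ^ j * T i = 2 * (of_bool (B i) * 3 ^ (j - Suc i))" if "i < j" for i
    proof -
      have "(3::real) ^ j = 3 ^ (j - Suc i) * (3 * 3 ^ i)"
        using that by (simp flip: power_add power_Suc)
      then show ?thesis by (simp add: T_def)
    qed
    then have "3 ^ j * (\<Sum>i<j. T i) = (\<Sum>i<j. 2 * (of_bool (B i) * 3 ^ (j - Suc i)))"
      unfolding sum_distrib_left by (intro sum.cong) auto
    then show ?thesis
      by (simp only: M_def of_nat_sum of_nat_mult of_nat_of_bool of_nat_power of_nat_numeral sum_distrib_left)
  qed
  define y where "y = of_bool (B j) * (2/3) + r"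
  have "(\<Sum>i. T i) = (\<Sum>i<j. T i) + T j + (\<Sum>i. T (i + Suc j))"
    using suminf_split_initial_segment[OF sT, of "Suc j"] by simp
  then have "3 ^ j * t = 3 ^ j * (2 * real N) + 3 ^ j * (\<Sum>i<j. T i) + 3 ^ j * T j + 3 ^ j * (\<Sum>i. T (i + Suc j))"
    unfolding t T_def[symmetric] by (simp only: distrib_left add.assoc)
  also have "\<dots> = 2 * real (3 ^ j * N + M) + y"
    unfolding head tail by (simp add: y_def T_def)
  finally have "pi * (3 ^ j * t) = 2 * real (3 ^ j * N + M) * pi + pi * y"
    by (simp add: algebra_simps)
  then have c: "cos (pi * (3 ^ j * t)) = cos (pi * y)"
    by (simp only: cos_add cos_2npi sin_2npi mult_1_left mult_zero_left diff_zero)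
  show ?thesis
  proof (cases "B j")
    case True
    then have "2 * pi / 3 \<le> pi * y" "pi * y \<le> pi"
      using r by (auto simp: y_def mult_le_cancel_left1 field_simps)
    then have "cos (pi * y) \<le> cos (2 * pi / 3)"
      by (intro cos_monotone_0_pi_le) auto
    then show ?thesis
      using True by (simp add: ternary_digit_def c cos_120)
  next
    case False
    then have "0 \<le> pi * y" "pi * y \<le> pi / 3"
      using r by (auto simp: y_def field_simps)
    then have "cos (pi / 3) \<le> cos (pi * y)"
      by (intro cos_monotone_0_pi_le) auto
    then show ?thesis
      using False by (simp add: ternary_digit_def c cos_60)
  qed
qed

lemma binary_expansion:
  fixes y :: real
  assumes "0 \<le> y" "y < 1"
  shows "\<exists>B. (\<lambda>j. of_bool (B j) / 2 ^ Suc j) sums y"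
proof
  define B where "B j = odd \<lfloor>2 ^ Suc j * y\<rfloor>" for j
  have "(\<Sum>j<n. of_bool (B j) / 2 ^ Suc j :: real) = of_int \<lfloor>2 ^ n * y\<rfloor> / 2 ^ n" for n
  proof (induction n)
    case 0
    have "\<lfloor>y\<rfloor> = 0" using assms by linarith
    then show ?case by simp
  next
    case (Suc n)
    have "\<lfloor>2 ^ Suc n * y\<rfloor> div 2 = \<lfloor>2 ^ n * y\<rfloor>"
      using floor_divide_real_eq_div[of 2 "2 ^ Suc n * y"] by simp
    then have "\<lfloor>2 ^ Suc n * y\<rfloor> = 2 * \<lfloor>2 ^ n * y\<rfloor> + of_bool (B n)"
      unfolding B_def by (metis mult_div_mod_eq odd_iff_mod_2_eq_one of_bool_eq even_iff_mod_2_eq_zero)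
    then have "real_of_int \<lfloor>2 ^ Suc n * y\<rfloor> = 2 * real_of_int \<lfloor>2 ^ n * y\<rfloor> + of_bool (B n)"
      by simp
    then show ?case
      using Suc by (simp add: field_simps)
  qed
  moreover have "(\<lambda>n. of_int \<lfloor>2 ^ n * y\<rfloor> / 2 ^ n) \<longlonglongrightarrow> y"
  proof (rule tendsto_sandwich)
    show "eventually (\<lambda>n. y - (1/2) ^ n \<le> of_int \<lfloor>2 ^ n * y\<rfloor> / 2 ^ n) sequentially"
    proof (intro always_eventually allI)
      fix n
      have "2 ^ n * y - 1 \<le> of_int \<lfloor>2 ^ n * y\<rfloor>" by linarith
      then have "(2 ^ n * y - 1) / 2 ^ n \<le> of_int \<lfloor>2 ^ n * y\<rfloor> / 2 ^ n"
        by (intro divide_right_mono) auto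
      then show "y - (1/2) ^ n \<le> of_int \<lfloor>2 ^ n * y\<rfloor> / 2 ^ n"
        by (simp add: diff_divide_distrib power_one_over)
    qed
    show "eventually (\<lambda>n. of_int \<lfloor>2 ^ n * y\<rfloor> / 2 ^ n \<le> y) sequentially"
      by (intro always_eventually allI) (simp add: divide_le_eq mult.commute)
    have "(\<lambda>n. y - (1/2) ^ n) \<longlonglongrightarrow> y - 0"
      by (intro tendsto_intros LIMSEQ_realpow_zero) auto
    then show "(\<lambda>n. y - (1/2) ^ n) \<longlonglongrightarrow> y" by simp
  qed auto
  ultimately show "(\<lambda>j. of_bool (B j) / 2 ^ Suc j) sums y"
    by (simp add: sums_def)
qed

text \<open>  Schoenberg's curve in each coordinate: the binary digits of the coordinates of a point of the unit cube are
  interleaved into the ternary digits of the parameter.  The curve is periodic, and is multiplied by a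
  continuous factor that equals \<open>2 * N\<close> on \<open>[2 * N, 2 * N + 1]\<close>, so that the \<open>N\<close>-th period covers the ball of
  radius \<open>N\<close>.\<close>

lemma space_filling_curve:
  obtains g :: "real \<Rightarrow> 'a::euclidean_space"
  where "continuous_on UNIV g" "\<And>N. cball 0 (real N) \<subseteq> g ` {0..2 * real N + 1}"
proof -
  define d where "d = DIM('a)"
  have d: "0 < d" by (simp add: d_def)
  obtain e where e: "bij_betw e (Basis::'a set) {0..<d}"
    using ex_bij_betw_finite_nat[OF finite_Basis] unfolding d_def by blast
  define F where "F b j t = ternary_digit (3 ^ (j * d + e b) * t) / 2 ^ Suc j" for b :: 'a and j t
  define P where "P b t = (\<Sum>j. F b j t)" for b t
  have contF: "continuous_on UNIV (F b j)" for b j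
    unfolding F_def ternary_digit_def by (intro continuous_intros) auto
  have contP: "continuous_on UNIV (P b)" for b
  proof (rule uniform_limit_theorem)
    show "uniform_limit UNIV (\<lambda>n t. \<Sum>j<n. F b j t) (P b) sequentially"
      unfolding P_def
    proof (rule Weierstrass_m_test)
      show "norm (F b j t) \<le> 1 / 2 ^ Suc j" for j t
        using ternary_digit_bounds[of "3 ^ (j * d + e b) * t"]
        unfolding F_def by (simp add: divide_right_mono del: power_Suc)
      have "summable (\<lambda>j. (1/2) * (1/2::real) ^ j)"
        by (intro summable_mult summable_geometric) auto
      then show "summable (\<lambda>j. 1 / 2 ^ Suc j :: real)"
        by (simp add: power_one_over)
    qed
    show "\<forall>\<^sub>F n in sequentially. continuous_on UNIV (\<lambda>t. \<Sum>j<n. F b j t)"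
      by (intro always_eventually allI continuous_on_sum contF)
  qed auto
  \<comment> \<open>The triangle wave \<open>arccos (cos (pi * t)) / pi\<close> equals \<open>t - 2 * N\<close> on \<open>[2 * N, 2 * N + 1]\<close>.\<close>
  define g where "g t = (t - arccos (cos (pi * t)) / pi) *\<^sub>R (\<Sum>b\<in>Basis. (2 * P b t - 1) *\<^sub>R b)" for t
  have "continuous_on UNIV g"
    unfolding g_def by (intro continuous_intros contP) auto
  moreover have "x \<in> g ` {0..2 * real N + 1}" if x: "norm x \<le> real N" for x and N :: nat
  proof (cases "N = 0")
    case True
    then have "x = g 0" using x by (simp add: g_def)
    then show ?thesis using True by auto
  next
    case False
    define y where "y b = (1 + (x \<bullet> b) / (2 * real N)) / 2" for b
    have "\<exists>B. (\<lambda>j. of_bool (B j) / 2 ^ Suc j) sums y b" if "b \<in> Basis" for b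
    proof (rule binary_expansion)
      have "\<bar>x \<bullet> b\<bar> \<le> real N" using that x by (meson Basis_le_norm order.trans)
      then show "0 \<le> y b" "y b < 1"
        using False by (auto simp: y_def field_simps abs_le_iff)
    qed
    then obtain B where B: "\<And>b. b \<in> Basis \<Longrightarrow> (\<lambda>j. of_bool (B b j) / 2 ^ Suc j) sums y b"
      by metis
    define C where "C m = B (the_inv_into Basis e (m mod d)) (m div d)" for m
    have C: "C (j * d + e b) = B b j" if "b \<in> Basis" for b j
    proof -
      have "e b < d" using e that by (auto simp: bij_betw_def)
      then show ?thesis
        using e that d by (simp add: C_def the_inv_into_f_f bij_betw_def)
    qed
    define \<tau> where "\<tau> = (\<Sum>i. of_bool (C i) * ((2/3) / 3 ^ i) :: real)"
    have \<tau>: "0 \<le> \<tau>" "\<tau> \<le> 1"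
      using ternary_bounds[of "2/3" C] by (auto simp: \<tau>_def)
    define t where "t = 2 * real N + \<tau>"
    have P: "P b t = y b" if "b \<in> Basis" for b
      unfolding P_def F_def using ternary_digit_eq[of t N C] C[OF that] B[OF that]
      by (simp add: t_def \<tau>_def sums_iff)
    have "cos (pi * t) = cos (pi * \<tau>)"
    proof -
      have "pi * t = 2 * real N * pi + pi * \<tau>" by (simp add: t_def algebra_simps)
      then show ?thesis by (simp only: cos_add cos_2npi sin_2npi mult_1_left mult_zero_left diff_zero)
    qed
    then have "arccos (cos (pi * t)) = pi * \<tau>"
      using \<tau> by (simp add: arccos_cos mult_le_cancel_left1)
    then have "g t = (2 * real N) *\<^sub>R (\<Sum>b\<in>Basis. (2 * P b t - 1) *\<^sub>R b)"
      unfolding g_def by (simp only:) (simp add: t_def)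
    also have "\<dots> = (2 * real N) *\<^sub>R (\<Sum>b\<in>Basis. (2 * y b - 1) *\<^sub>R b)"
      by (simp add: P)
    also have "\<dots> = (\<Sum>b\<in>Basis. (x \<bullet> b) *\<^sub>R b)"
      unfolding scaleR_sum_right using False by (intro sum.cong) (auto simp: y_def field_simps)
    finally have "g t = x" by (simp add: euclidean_representation)
    then show ?thesis using \<tau> by (intro image_eqI[of _ _ t]) (auto simp: t_def)
  qed
  ultimately show ?thesis
    by (intro that[of g] subsetI) simp_all
qed

text \<open>  The first time at which the curve visits \<open>x\<close> depends measurably on \<open>x\<close>: the points visited up to time \<open>a\<close> form
  the image of a compact interval, which is closed.\<close>

lemma space_filling_curve_section:
  obtains g :: "real \<Rightarrow> 'a::euclidean_space" and h :: "'a \<Rightarrow> real"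
  where "continuous_on UNIV g" "h \<in> borel_measurable borel" "\<And>x. g (h x) = x"
    "\<And>N x. norm x \<le> real N \<Longrightarrow> 0 \<le> h x \<and> h x \<le> 2 * real N + 1"
proof -
  obtain g :: "real \<Rightarrow> 'a" where g: "continuous_on UNIV g"
    "\<And>N. cball 0 (real N) \<subseteq> g ` {0..2 * real N + 1}"
    using space_filling_curve by blast
  define T where "T x = {t. 0 \<le> t \<and> g t = x}" for x
  define h where "h x = Inf (T x)" for x
  have T: "\<exists>t \<in> T x. t \<le> 2 * real N + 1" if "norm x \<le> real N" for x N
    using g(2)[of N] that by (fastforce simp: T_def)
  have bdd: "bdd_below (T x)" for x
    by (auto simp: T_def intro!: bdd_belowI[of _ 0])
  have hT: "h x \<in> T x" for x
    unfolding h_def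
  proof (rule closed_contains_Inf)
    obtain N where "norm x \<le> real N" using real_arch_simple by blast
    then show "T x \<noteq> {}" using T by blast
    have "T x = {0..} \<inter> g -` {x}" by (auto simp: T_def)
    then show "closed (T x)"
      using g(1) by (simp add: closed_Int closed_vimage)
  qed (rule bdd)
  have hle: "h x \<le> t" if "t \<in> T x" for x t
    unfolding h_def using bdd that by (intro cInf_lower)
  have "h \<in> borel_measurable borel"
    unfolding borel_measurable_iff_le
  proof
    fix a
    have "{x. h x \<le> a} = g ` {0..a}"
    proof safe
      fix x assume "h x \<le> a"
      then show "x \<in> g ` {0..a}"
        using hT[of x] by (intro image_eqI[of _ _ "h x"]) (auto simp: T_def)
    next
      fix t assume "t \<in> {0..a}"
      then show "h (g t) \<le> a"
        using hle[of t "g t"] by (auto simp: T_def)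
    qed
    moreover have "closed (g ` {0..a})"
      using g(1) by (intro compact_imp_closed compact_continuous_image) (auto intro: continuous_on_subset)
    ultimately show "{w \<in> space borel. h w \<le> a} \<in> sets borel" by simp
  qed
  moreover have "g (h x) = x" "0 \<le> h x" for x using hT[of x] by (auto simp: T_def)
  moreover have "h x \<le> 2 * real N + 1" if "norm x \<le> real N" for x N
    using T[OF that] hle by fastforce
  ultimately show ?thesis using that g(1) by blast
qed

section \<open>Weak sequential compactness\<close>

text \<open>  Push the measures to the line with the section \<open>h\<close>, apply Helly's selection theorem there, and push the limit
  back with the curve \<open>g\<close>.  Only \<open>g\<close> has to be continuous, because \<open>f = f \<circ> g \<circ> h\<close> and the test function on the line
  is \<open>f \<circ> g\<close>.  Tightness survives since \<open>h\<close> is bounded on bounded sets.\<close>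

lemma tight_imp_weakly_convergent_subsequence:
  fixes \<mu> :: "nat \<Rightarrow> 'a::euclidean_space measure"
  assumes \<mu>: "\<And>n. prob_space (\<mu> n)" "\<And>n. sets (\<mu> n) = sets borel"
    and tight: "\<And>\<epsilon>. 0 < \<epsilon> \<Longrightarrow> \<exists>N::nat. \<forall>n. 1 - \<epsilon> < measure (\<mu> n) (cball 0 (real N))"
  obtains r \<nu> where "strict_mono r" "prob_space \<nu>" "sets \<nu> = sets borel"
    "\<forall>(f :: 'a \<Rightarrow> complex) B. continuous_on UNIV f \<longrightarrow> (\<forall>x. norm (f x) \<le> B) \<longrightarrow>
        (\<lambda>n. LINT v|\<mu> (r n). f v) \<longlonglongrightarrow> (LINT v|\<nu>. f v)"
proof -
  obtain g :: "real \<Rightarrow> 'a" and h where g: "continuous_on UNIV g"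
    and h[measurable]: "h \<in> borel_measurable borel" and gh: "\<And>x. g (h x) = x"
    and hN: "\<And>N x. norm x \<le> real N \<Longrightarrow> 0 \<le> h x \<and> h x \<le> 2 * real N + 1"
    using space_filling_curve_section by blast
  have g_meas[measurable]: "g \<in> borel_measurable borel"
    using g by (rule borel_measurable_continuous_onI)
  have h_meas: "h \<in> borel_measurable (\<mu> n)" for n
    by (simp cong: measurable_cong_sets add: \<mu>)
  define M where "M n = distr (\<mu> n) borel h" for n
  have rd: "real_distribution (M n)" for n
    unfolding M_def using \<mu>(1) h_meas by (intro prob_space.real_distribution_distr)
  have "tight M"
    unfolding tight_def
  proof (intro conjI allI impI rd)
    fix \<epsilon> :: real assume "0 < \<epsilon>"
    then obtain N :: nat where N: "\<And>n. 1 - \<epsilon> < measure (\<mu> n) (cball 0 (real N))"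
      using tight by blast
    have "1 - \<epsilon> < measure (M n) {-1<..2 * real N + 1}" for n
    proof -
      interpret prob_space "\<mu> n" by (rule \<mu>)
      have "measure (\<mu> n) (cball 0 (real N)) \<le> measure (\<mu> n) (h -` {-1<..2 * real N + 1} \<inter> space (\<mu> n))"
      proof (rule finite_measure_mono)
        show "cball 0 (real N) \<subseteq> h -` {-1<..2 * real N + 1} \<inter> space (\<mu> n)"
          using hN[of _ N] sets_eq_imp_space_eq[OF \<mu>(2)[of n]] by fastforce
        show "h -` {-1<..2 * real N + 1} \<inter> space (\<mu> n) \<in> sets (\<mu> n)"
          by (rule measurable_sets[OF h_meas]) auto
      qed
      then show ?thesis
        using N[of n] h_meas by (simp add: M_def measure_distr)
    qed
    then show "\<exists>a b. a < b \<and> (\<forall>n. 1 - \<epsilon> < measure (M n) {a<..b})"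
      by (intro exI[of _ "-1"] exI[of _ "2 * real N + 1"]) auto
  qed
  from tight_imp_convergent_subsubsequence[OF this strict_mono_id]
  obtain r L where r: "strict_mono r" and L: "real_distribution L" "weak_conv_m (M \<circ> id \<circ> r) L"
    by blast
  interpret L: real_distribution L by fact
  have gL: "g \<in> borel_measurable L" by simp
  show ?thesis
  proof
    show "strict_mono r" by fact
    show "prob_space (distr L borel g)" by (rule L.prob_space_distr[OF gL])
    show "sets (distr L borel g) = sets borel" by simp
    show "\<forall>(f :: 'a \<Rightarrow> complex) B. continuous_on UNIV f \<longrightarrow> (\<forall>x. norm (f x) \<le> B) \<longrightarrow>
        (\<lambda>n. LINT v|\<mu> (r n). f v) \<longlonglongrightarrow> (LINT v|distr L borel g. f v)"
    proof (intro allI impI)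
      fix f :: "'a \<Rightarrow> complex" and B
      assume f: "continuous_on UNIV f" "\<forall>x. norm (f x) \<le> B"
      have fm[measurable]: "f \<in> borel_measurable borel"
        using f(1) by (rule borel_measurable_continuous_onI)
      have "(\<lambda>n. integral\<^sup>L ((M \<circ> id \<circ> r) n) (\<lambda>t. f (g t))) \<longlonglongrightarrow> integral\<^sup>L L (\<lambda>t. f (g t))"
      proof (rule weak_conv_imp_integral_bdd_continuous_conv)
        show "isCont (\<lambda>t. f (g t)) x" for x
          using continuous_on_compose2[OF f(1) g] by (simp add: continuous_on_eq_continuous_at)
      qed (use rd L f in \<open>auto simp: o_def\<close>)
      moreover have "integral\<^sup>L ((M \<circ> id \<circ> r) n) (\<lambda>t. f (g t)) = (LINT v|\<mu> (r n). f v)" for n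
        unfolding M_def comp_def id_def by (subst integral_distr) (auto simp: gh h_meas)
      moreover have "integral\<^sup>L L (\<lambda>t. f (g t)) = (LINT v|distr L borel g. f v)"
        by (subst integral_distr) (auto simp: gL)
      ultimately show "(\<lambda>n. LINT v|\<mu> (r n). f v) \<longlonglongrightarrow> (LINT v|distr L borel g. f v)"
        by simp
    qed
  qed
qed

text \<open>  Tightness is Markov's inequality.  The moment of the limit is bounded by testing weak convergence against
  the truncations \<open>min (norm v powr \<alpha>) m\<close>.\<close>

lemma moment_bounded_weakly_convergent_subsequence:
  fixes \<mu> :: "nat \<Rightarrow> 'a::euclidean_space measure"
  assumes \<alpha>: "0 < \<alpha>" and \<mu>: "\<And>n. \<mu> n \<in> prob_moment \<alpha>"
    and B: "\<And>n. (LINT v|\<mu> n. norm v powr \<alpha>) \<le> B"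
  obtains r \<nu> where "strict_mono r" "\<nu> \<in> prob_moment \<alpha>"
    "\<And>\<xi>. (\<lambda>n. fourier (\<mu> (r n)) \<xi>) \<longlonglongrightarrow> fourier \<nu> \<xi>"
proof -
  have \<mu>P: "prob_space (\<mu> n)" "sets (\<mu> n) = sets borel" "integrable (\<mu> n) (\<lambda>v. norm v powr \<alpha>)" for n
    using \<mu>[of n] by (auto simp: prob_moment_def)
  have "\<exists>N::nat. \<forall>n. 1 - \<epsilon> < measure (\<mu> n) (cball 0 (real N))" if \<epsilon>: "0 < \<epsilon>" for \<epsilon>
  proof -
    obtain N :: nat where N: "(\<bar>B\<bar> / \<epsilon> + 1) powr (1 / \<alpha>) \<le> real N"
      using real_arch_simple by blast
    have "\<bar>B\<bar> / \<epsilon> + 1 = ((\<bar>B\<bar> / \<epsilon> + 1) powr (1 / \<alpha>)) powr \<alpha>"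
      using \<alpha> \<epsilon> by (simp add: powr_powr add_nonneg_pos)
    also have "\<dots> \<le> real N powr \<alpha>"
      using N \<alpha> by (intro powr_mono2) auto
    finally have N': "\<bar>B\<bar> / \<epsilon> < real N powr \<alpha>" by simp
    have pos: "0 < real N powr \<alpha>"
      using N' \<epsilon> by (smt (verit) divide_nonneg_pos abs_ge_zero)
    have "1 - \<epsilon> < measure (\<mu> n) (cball 0 (real N))" for n
    proof -
      interpret prob_space "\<mu> n" by (rule \<mu>P)
      note \<mu>P(2)[measurable_cong]
      have c: "cball 0 (real N) \<in> sets (\<mu> n)" by (simp add: \<mu>P)
      have sp: "space (\<mu> n) = UNIV" using sets_eq_imp_space_eq[OF \<mu>P(2)[of n]] by simp
      have "real N powr \<alpha> * measure (\<mu> n) (- cball 0 (real N)) = (LINT v|\<mu> n. real N powr \<alpha> * indicator (- cball 0 (real N)) v)"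
        using sp by simp
      also have "\<dots> \<le> (LINT v|\<mu> n. norm v powr \<alpha>)"
      proof (intro integral_mono \<mu>P(3))
        show "integrable (\<mu> n) (\<lambda>v. real N powr \<alpha> * indicator (- cball 0 (real N)) v)"
          by (intro integrable_mult_right integrable_bounded_borel[OF \<mu>P(1,2), where B=1]) (auto simp: indicator_def)
        show "real N powr \<alpha> * indicator (- cball 0 (real N)) v \<le> norm v powr \<alpha>" for v
          using \<alpha> by (auto simp: indicator_def intro!: powr_mono2)
      qed
      also have "\<dots> \<le> \<bar>B\<bar>" using B[of n] by linarith
      also have "\<dots> < real N powr \<alpha> * \<epsilon>" using N' \<epsilon> by (simp add: divide_less_eq)
      finally have "measure (\<mu> n) (- cball 0 (real N)) < \<epsilon>" using pos by simp
      moreover have "measure (\<mu> n) (- cball 0 (real N)) = 1 - measure (\<mu> n) (cball 0 (real N))"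
        using prob_compl[OF c] sp by (simp add: Compl_eq_Diff_UNIV)
      ultimately show ?thesis by simp
    qed
    then show ?thesis by blast
  qed
  from tight_imp_weakly_convergent_subsequence[OF \<mu>P(1,2) this]
  obtain r \<nu> where r: "strict_mono r" and \<nu>: "prob_space \<nu>" "sets \<nu> = sets borel"
    and weak: "\<forall>(f :: 'a \<Rightarrow> complex) B. continuous_on UNIV f \<longrightarrow> (\<forall>x. norm (f x) \<le> B) \<longrightarrow>
        (\<lambda>n. LINT v|\<mu> (r n). f v) \<longlonglongrightarrow> (LINT v|\<nu>. f v)"
    by blast
  have lim: "(\<lambda>n. LINT v|\<mu> (r n). f v) \<longlonglongrightarrow> (LINT v|\<nu>. f v)"
    if "continuous_on UNIV f" "\<And>x. norm (f x) \<le> B" for f :: "'a \<Rightarrow> complex" and B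
    using weak that by blast
  note \<nu>(2)[measurable_cong]
  have "(\<lambda>n. fourier (\<mu> (r n)) \<xi>) \<longlonglongrightarrow> fourier \<nu> \<xi>" for \<xi>
    unfolding fourier_def using norm_exp_i_times[of "- (\<xi> \<bullet> _)"]
    by (intro lim[where B=1] continuous_intros) auto
  moreover have "\<nu> \<in> prob_moment \<alpha>"
  proof -
    define f where "f m v = min (norm v powr \<alpha>) (real m)" for m :: nat and v :: 'a
    have f_meas[measurable]: "f m \<in> borel_measurable borel" for m
      unfolding f_def by measurable
    have f_bound: "norm (f m v) \<le> real m" for m v by (simp add: f_def)
    have f_cont: "continuous_on UNIV (\<lambda>v. complex_of_real (f m v))" for m
      unfolding f_def using \<alpha> by (intro continuous_intros continuous_on_powr') auto
    have "(LINT v|\<nu>. f m v) \<le> B" for m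
    proof (rule LIMSEQ_le_const2)
      have "(\<lambda>n. LINT v|\<mu> (r n). complex_of_real (f m v)) \<longlonglongrightarrow> (LINT v|\<nu>. complex_of_real (f m v))"
        using f_bound by (intro lim[OF f_cont]) auto
      then show "(\<lambda>n. LINT v|\<mu> (r n). f m v) \<longlonglongrightarrow> (LINT v|\<nu>. f m v)"
        by (simp only: integral_complex_of_real tendsto_of_real_iff)
      have "(LINT v|\<mu> (r n). f m v) \<le> (LINT v|\<mu> (r n). norm v powr \<alpha>)" for n
        by (intro integral_mono \<mu>P(3) integrable_bounded_borel[OF \<mu>P(1,2) f_meas f_bound]) (simp add: f_def)
      then show "\<exists>N. \<forall>n\<ge>N. (LINT v|\<mu> (r n). f m v) \<le> B"
        using B order.trans by blast
    qed
    then have fB: "(\<integral>\<^sup>+v. ennreal (f m v) \<partial>\<nu>) \<le> ennreal B" for m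
      using nn_integral_eq_integral[OF integrable_bounded_borel[OF \<nu> f_meas f_bound], of m]
      by (simp add: f_def ennreal_leI)
    have "(\<integral>\<^sup>+v. ennreal (norm v powr \<alpha>) \<partial>\<nu>) = (\<integral>\<^sup>+v. liminf (\<lambda>m. ennreal (f m v)) \<partial>\<nu>)"
    proof (rule nn_integral_cong)
      fix v :: 'a
      obtain M :: nat where M: "norm v powr \<alpha> \<le> real M" using real_arch_simple by blast
      have "(\<lambda>m. ennreal (f m v)) \<longlonglongrightarrow> ennreal (norm v powr \<alpha>)"
      proof (rule tendsto_eventually)
        show "\<forall>\<^sub>F m in sequentially. ennreal (f m v) = ennreal (norm v powr \<alpha>)"
          using eventually_ge_at_top[of M]
        proof eventually_elim
          case (elim m)
          then have "norm v powr \<alpha> \<le> real m" using M by linarith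
          then show ?case by (simp add: f_def)
        qed
      qed
      then show "ennreal (norm v powr \<alpha>) = liminf (\<lambda>m. ennreal (f m v))"
        by (intro lim_imp_Liminf[symmetric]) auto
    qed
    also have "\<dots> \<le> liminf (\<lambda>m. \<integral>\<^sup>+v. ennreal (f m v) \<partial>\<nu>)"
      by (intro nn_integral_liminf) simp
    also have "\<dots> \<le> liminf (\<lambda>m. ennreal B)"
      using fB by (intro Liminf_mono always_eventually) auto
    also have "\<dots> < \<infinity>" by (simp add: Liminf_const)
    finally have "integrable \<nu> (\<lambda>v. norm v powr \<alpha>)"
      by (intro integrableI_bounded) auto
    then show ?thesis using \<nu> by (simp add: prob_moment_def)
  qed
  ultimately show ?thesis using that r by blast
qed

section \<open>The difference kernel and its weighted integral\<close>

lemma borel_measurable_fourier: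
  assumes "prob_space \<mu>" and [measurable_cong]: "sets \<mu> = sets borel"
  shows "fourier \<mu> \<in> borel_measurable borel"
proof -
  interpret prob_space \<mu> by fact
  show ?thesis
    unfolding fourier_def[abs_def] by measurable
qed

text \<open>  The \<open>k\<close>-th difference at \<open>0\<close>, with step \<open>\<xi>\<close>, of the character \<open>\<eta> \<mapsto> exp (- \<i> \<eta> \<bullet> v)\<close>, as a function of \<open>s = \<xi> \<bullet> v\<close>.\<close>

definition diff_kernel :: "nat \<Rightarrow> real \<Rightarrow> complex" where
  "diff_kernel k s = (exp (- \<i> * complex_of_real s) - 1) ^ k"

lemma borel_measurable_diff_kernel [measurable]: "diff_kernel k \<in> borel_measurable borel"
  unfolding diff_kernel_def by measurable

lemma diff_kernel_eq_sum:
  "diff_kernel k s = (\<Sum>m\<le>k. of_nat (k choose m) * (-1) ^ (k - m) * exp (- \<i> * complex_of_real (real m * s)))"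
proof -
  have "exp (- \<i> * complex_of_real s) ^ m = exp (- \<i> * complex_of_real (real m * s))" for m
    by (simp add: exp_of_nat_mult[symmetric] mult_ac)
  then show ?thesis
    unfolding diff_kernel_def using binomial_ring[of "exp (- \<i> * complex_of_real s)" "-1" k]
    by (simp add: mult_ac)
qed

lemma norm_exp_minus_one_le: "norm (exp (- \<i> * complex_of_real s) - 1) \<le> \<bar>s\<bar>"
  "norm (exp (- \<i> * complex_of_real s) - 1) \<le> 2"
proof -
  show "norm (exp (- \<i> * complex_of_real s) - 1) \<le> \<bar>s\<bar>"
    using iexp_approx1[of "-s" 0] by simp
  show "norm (exp (- \<i> * complex_of_real s) - 1) \<le> 2"
    using norm_triangle_ineq4[of "exp (- \<i> * complex_of_real s)" 1] norm_exp_i_times[of "-s"] by simp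
qed

lemma norm_diff_kernel_le: "norm (diff_kernel k s) \<le> 2 ^ k"
  unfolding diff_kernel_def norm_power by (intro power_mono norm_exp_minus_one_le) auto

lemma fdiff_fourier:
  assumes \<mu>: "prob_space \<mu>" "sets \<mu> = sets borel"
  shows "fdiff k \<xi> (fourier \<mu>) = (LINT v|\<mu>. diff_kernel k (\<xi> \<bullet> v))"
proof -
  have "integrable \<mu> (\<lambda>v. exp (- \<i> * complex_of_real (x \<bullet> v)))" for x
    by (intro integrable_bounded_borel[OF \<mu>, where B=1]) auto
  then have "(LINT v|\<mu>. diff_kernel k (\<xi> \<bullet> v)) =
      (\<Sum>m\<le>k. LINT v|\<mu>. of_nat (k choose m) * (-1) ^ (k - m) * exp (- \<i> * complex_of_real ((real m *\<^sub>R \<xi>) \<bullet> v)))"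
    unfolding diff_kernel_eq_sum inner_scaleR_left[symmetric]
    by (intro Bochner_Integration.integral_sum integrable_mult_right)
  also have "\<dots> = (\<Sum>m\<le>k. of_nat (k choose m) * (-1) ^ (k - m) * fourier \<mu> (real m *\<^sub>R \<xi>))"
    by (simp only: fourier_def integral_mult_right_zero)
  finally show ?thesis
    by (simp add: fdiff_def atMost_atLeast0)
qed

lemma fdiff_bounded_linear:
  fixes L :: "complex \<Rightarrow> 'b::real_normed_field"
  assumes "bounded_linear L"
  shows "fdiff k \<xi> (\<lambda>x. L (\<phi> x)) = L (fdiff k \<xi> \<phi>)"
proof -
  interpret bounded_linear L by fact
  have "of_nat n * (-1) ^ j * L z = L (of_nat n * (-1) ^ j * z)" for n j z
  proof -
    have "of_nat n * (-1) ^ j * L z = (real n * (-1) ^ j) *\<^sub>R L z"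
      by (simp add: scaleR_conv_of_real)
    also have "\<dots> = L ((real n * (-1) ^ j) *\<^sub>R z)" by (simp add: scaleR)
    also have "(real n * (-1) ^ j) *\<^sub>R z = of_nat n * (-1) ^ j * z"
      by (simp add: scaleR_conv_of_real)
    finally show ?thesis .
  qed
  then show ?thesis by (simp add: fdiff_def sum)
qed

lemma fdiff_diff: "fdiff k \<xi> (\<lambda>x. \<phi> x - \<psi> x) = fdiff k \<xi> \<phi> - fdiff k \<xi> \<psi>"
  by (simp add: fdiff_def right_diff_distrib sum_subtractf)

text \<open>  Bounding \<open>\<bar>\<xi> \<bullet> v\<bar>\<close> by \<open>norm v * norm \<xi>\<close> and rescaling \<open>\<xi>\<close> by \<open>norm v\<close> extracts \<open>norm v powr \<alpha>\<close> and leaves a constant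
  that is independent of the direction of \<open>v\<close>.\<close>

lemma nn_integral_riesz_growth:
  fixes v :: "'a::euclidean_space" and f :: "real \<Rightarrow> real"
  assumes b: "0 \<le> b" "b \<le> a" and C: "0 \<le> C"
    and f: "\<And>s. \<bar>f s\<bar> \<le> C * min (\<bar>s\<bar> powr a) (\<bar>s\<bar> powr b)"
  shows "(\<integral>\<^sup>+\<xi>. ennreal \<bar>f (\<xi> \<bullet> v)\<bar> \<partial>riesz \<alpha>) \<le>
    ennreal (C * norm v powr \<alpha>) * (\<integral>\<^sup>+\<xi>. ennreal (min (norm \<xi> powr a) (norm \<xi> powr b)) \<partial>(riesz \<alpha> :: 'a measure))"
proof (cases "v = 0")
  case True
  then have "f (\<xi> \<bullet> v) = 0" for \<xi> using f[of 0] by simp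
  then show ?thesis by simp
next
  case False
  define g where "g \<xi> = ennreal (min (norm \<xi> powr a) (norm \<xi> powr b))" for \<xi> :: 'a
  have [measurable]: "g \<in> borel_measurable borel" unfolding g_def by measurable
  have "ennreal \<bar>f (\<xi> \<bullet> v)\<bar> \<le> ennreal C * g (norm v *\<^sub>R \<xi>)" for \<xi>
  proof -
    have le: "\<bar>\<xi> \<bullet> v\<bar> \<le> norm (norm v *\<^sub>R \<xi>)"
      using Cauchy_Schwarz_ineq2[of \<xi> v] by (simp add: mult.commute)
    have "\<bar>f (\<xi> \<bullet> v)\<bar> \<le> C * min (\<bar>\<xi> \<bullet> v\<bar> powr a) (\<bar>\<xi> \<bullet> v\<bar> powr b)" by (rule f)
    also have "\<dots> \<le> C * min (norm (norm v *\<^sub>R \<xi>) powr a) (norm (norm v *\<^sub>R \<xi>) powr b)"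
      using C b le by (intro mult_left_mono min.mono powr_mono2) auto
    finally show ?thesis
      using C by (simp add: g_def ennreal_mult'[symmetric] del: norm_scaleR)
  qed
  then have "(\<integral>\<^sup>+\<xi>. ennreal \<bar>f (\<xi> \<bullet> v)\<bar> \<partial>riesz \<alpha>) \<le> (\<integral>\<^sup>+\<xi>. ennreal C * g (norm v *\<^sub>R \<xi>) \<partial>riesz \<alpha>)"
    by (intro nn_integral_mono)
  also have "\<dots> = ennreal C * (ennreal (norm v powr \<alpha>) * (\<integral>\<^sup>+\<xi>. g \<xi> \<partial>riesz \<alpha>))"
    using False by (simp add: nn_integral_cmult nn_integral_riesz_scale)
  finally show ?thesis
    using C by (simp add: g_def ennreal_mult mult.assoc)
qed

lemma integrable_riesz_growth:
  fixes v :: "'a::euclidean_space" and f :: "real \<Rightarrow> real"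
  assumes b: "0 \<le> b" "b < \<alpha>" "\<alpha> < a" and C: "0 \<le> C"
    and [measurable]: "f \<in> borel_measurable borel"
    and f: "\<And>s. \<bar>f s\<bar> \<le> C * min (\<bar>s\<bar> powr a) (\<bar>s\<bar> powr b)"
  shows "integrable (riesz \<alpha>) (\<lambda>\<xi>. f (\<xi> \<bullet> v))"
proof (rule integrableI_bounded)
  have "(\<integral>\<^sup>+\<xi>. ennreal \<bar>f (\<xi> \<bullet> v)\<bar> \<partial>riesz \<alpha>) \<le>
    ennreal (C * norm v powr \<alpha>) * (\<integral>\<^sup>+\<xi>. ennreal (min (norm \<xi> powr a) (norm \<xi> powr b)) \<partial>(riesz \<alpha> :: 'a measure))"
    using b by (intro nn_integral_riesz_growth C f) auto
  also have "\<dots> < \<infinity>"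
    using riesz_min_powr_finite[OF b, where 'a='a] by (simp add: ennreal_mult_less_top)
  finally show "(\<integral>\<^sup>+\<xi>. ennreal (norm (f (\<xi> \<bullet> v))) \<partial>riesz \<alpha>) < \<infinity>" by simp
qed simp

lemma cos_rem_zero: "0 < p \<Longrightarrow> cos_rem p 0 = 0"
  using cos_rem_growth[of p 0] by (simp add: power_0_left)

lemma borel_measurable_cos_rem [measurable]: "cos_rem p \<in> borel_measurable borel"
  unfolding cos_rem_def[abs_def] by measurable

lemma cos_rem_growth_powr:
  assumes "0 < p"
  shows "\<bar>cos_rem p s\<bar> \<le> 2 * min (\<bar>s\<bar> powr (2 * real p)) (\<bar>s\<bar> powr (2 * real p - 2))"
proof (cases "s = 0")
  case True
  then show ?thesis using cos_rem_zero[OF assms] by simp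
next
  case False
  have "0 < \<bar>s\<bar>" using False by simp
  have 1: "2 * real p = real (2 * p)" "2 * real p - 2 = real (2 * p - 2)" using assms by auto
  show ?thesis
    using cos_rem_growth[OF assms, of s] unfolding 1(2) unfolding 1(1)
    by (simp only: powr_realpow[OF \<open>0 < \<bar>s\<bar>\<close>])
qed

context
  fixes p :: nat and \<alpha> :: real
  assumes p: "0 < p" "2 * real p - 2 < \<alpha>" "\<alpha> < 2 * real p"
begin

lemma integrable_cos_rem:
  "integrable (riesz \<alpha>) (\<lambda>\<xi>::'a::euclidean_space. cos_rem p (\<xi> \<bullet> v))"
  using p cos_rem_growth_powr[OF p(1)]
  by (intro integrable_riesz_growth[where a="2 * real p" and b="2 * real p - 2" and C=2]) auto

lemma integral_cos_rem_scale:
  assumes "0 \<le> c"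
  shows "(LINT \<xi>|riesz \<alpha>. cos_rem p (c * (\<xi> \<bullet> v))) =
    c powr \<alpha> * (LINT \<xi>|(riesz \<alpha> :: 'a::euclidean_space measure). cos_rem p (\<xi> \<bullet> v))"
proof (cases "c = 0")
  case True
  then show ?thesis using cos_rem_zero[OF p(1)] by simp
next
  case False
  then show ?thesis
    using assms integral_riesz_scale[of "\<lambda>\<xi>. cos_rem p (\<xi> \<bullet> v)" c \<alpha>] by simp
qed

text \<open>  By homogeneity it suffices to bound the integral below uniformly over unit vectors \<open>e\<close>.  The integrand has a
  constant sign, so it may be restricted to the ball of radius \<open>1/4\<close> around \<open>e / 2\<close>.  There \<open>\<xi> \<bullet> e\<close> lies between \<open>1/4\<close> and \<open>1\<close>,
  the weight is at least \<open>1\<close>, and the volume of the ball does not depend on \<open>e\<close>.\<close>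

lemma integral_cos_rem_lower:
  "\<exists>\<kappa>>0. \<forall>v. \<kappa> * norm v powr \<alpha> \<le> (-1) ^ p * (LINT \<xi>|(riesz \<alpha> :: 'a::euclidean_space measure). cos_rem p (\<xi> \<bullet> v))"
proof -
  define c :: real where "c = (1/4) ^ (2*p) / (2 * fact (2*p))"
  have c: "0 < c" by (simp add: c_def)
  define \<kappa> where "\<kappa> = c * (unit_ball_vol (DIM('a)) * (1/4) ^ DIM('a))"
  have unit: "\<kappa> \<le> (-1) ^ p * (LINT \<xi>|(riesz \<alpha> :: 'a measure). cos_rem p (\<xi> \<bullet> e))" if e: "norm e = 1" for e :: 'a
  proof -
    let ?B = "ball (e /\<^sub>R 2) (1/4)"
    obtain q where q: "p = Suc q" using p by (cases p) auto
    have B: "1/4 \<le> \<xi> \<bullet> e" "\<xi> \<bullet> e \<le> 1" "norm \<xi> \<le> 1" if "\<xi> \<in> ?B" for \<xi>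
    proof -
      have n: "norm (\<xi> - e /\<^sub>R 2) \<le> 1/4"
        using that by (simp add: dist_norm norm_minus_commute)
      have "\<bar>(\<xi> - e /\<^sub>R 2) \<bullet> e\<bar> \<le> 1/4"
        using Cauchy_Schwarz_ineq2[of "\<xi> - e /\<^sub>R 2" e] n e by simp
      moreover have "(\<xi> - e /\<^sub>R 2) \<bullet> e = \<xi> \<bullet> e - 1/2"
        using e by (simp add: inner_diff_left norm_eq_1)
      ultimately have "\<bar>\<xi> \<bullet> e - 1/2\<bar> \<le> 1/4" by (simp only:)
      then show "1/4 \<le> \<xi> \<bullet> e" "\<xi> \<bullet> e \<le> 1" by linarith+
      have "norm \<xi> \<le> norm (\<xi> - e /\<^sub>R 2) + norm (e /\<^sub>R 2)"
        by (metis diff_add_cancel norm_triangle_ineq)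
      then show "norm \<xi> \<le> 1" using n e by simp
    qed
    have low: "c \<le> (-1) ^ p * cos_rem p (\<xi> \<bullet> e)" if "\<xi> \<in> ?B" for \<xi>
    proof -
      have "c \<le> (\<xi> \<bullet> e) ^ (2*p) / (2 * fact (2*p))"
        unfolding c_def using B[OF that] by (intro divide_right_mono power_mono) auto
      also have "\<dots> \<le> (-1) ^ p * cos_rem p (\<xi> \<bullet> e)"
        using B[OF that] by (intro cos_rem_lower) auto
      finally show ?thesis .
    qed
    have nn: "0 \<le> (-1) ^ p * cos_rem p s" for s
      unfolding q by (rule cos_rem_sign)
    have "ennreal \<kappa> = ennreal c * emeasure lborel ?B"
      using c by (simp add: \<kappa>_def emeasure_ball ennreal_mult')
    also have "\<dots> = (\<integral>\<^sup>+\<xi>. ennreal c * indicator ?B \<xi> \<partial>lborel)"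
      by (simp add: nn_integral_cmult_indicator)
    also have "\<dots> \<le> (\<integral>\<^sup>+\<xi>. ennreal (1 / norm \<xi> powr (real DIM('a) + \<alpha>)) * ennreal ((-1) ^ p * cos_rem p (\<xi> \<bullet> e)) \<partial>lborel)"
    proof (rule nn_integral_mono)
      fix \<xi> :: 'a
      show "ennreal c * indicator ?B \<xi> \<le> ennreal (1 / norm \<xi> powr (real DIM('a) + \<alpha>)) * ennreal ((-1) ^ p * cos_rem p (\<xi> \<bullet> e))"
      proof (cases "\<xi> \<in> ?B")
        case True
        have "\<xi> \<noteq> 0" using B(1)[OF True] by auto
        moreover have "norm \<xi> powr (real DIM('a) + \<alpha>) \<le> 1"
          using B(3)[OF True] p by (intro powr_le1) auto
        ultimately have "1 \<le> 1 / norm \<xi> powr (real DIM('a) + \<alpha>)"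
          by (simp add: le_divide_eq)
        then have "1 * c \<le> 1 / norm \<xi> powr (real DIM('a) + \<alpha>) * ((-1) ^ p * cos_rem p (\<xi> \<bullet> e))"
          using low[OF True] c by (intro mult_mono) auto
        then show ?thesis
          using True nn by (simp add: ennreal_mult[symmetric] del: times_divide_eq_left)
      qed auto
    qed
    also have "\<dots> = (\<integral>\<^sup>+\<xi>. ennreal ((-1) ^ p * cos_rem p (\<xi> \<bullet> e)) \<partial>riesz \<alpha>)"
      by (subst nn_integral_riesz) auto
    also have "\<dots> = ennreal (LINT \<xi>|riesz \<alpha>. (-1) ^ p * cos_rem p (\<xi> \<bullet> e))"
      using nn by (intro nn_integral_eq_integral integrable_mult_right integrable_cos_rem) auto
    finally have le: "ennreal \<kappa> \<le> ennreal (LINT \<xi>|riesz \<alpha>. (-1) ^ p * cos_rem p (\<xi> \<bullet> e))" .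
    have "0 \<le> (LINT \<xi>|riesz \<alpha>. (-1) ^ p * cos_rem p (\<xi> \<bullet> e))"
      by (rule Bochner_Integration.integral_nonneg) (rule nn)
    from le[unfolded ennreal_le_iff[OF this]] show ?thesis by simp
  qed
  have "\<kappa> * norm v powr \<alpha> \<le> (-1) ^ p * (LINT \<xi>|(riesz \<alpha> :: 'a measure). cos_rem p (\<xi> \<bullet> v))" for v :: 'a
  proof (cases "v = 0")
    case True
    then show ?thesis using cos_rem_zero[OF p(1)] by simp
  next
    case False
    define e where "e = v /\<^sub>R norm v"
    have e: "norm e = 1" "norm v * (\<xi> \<bullet> e) = \<xi> \<bullet> v" for \<xi>
      using False by (simp_all add: e_def)
    have "\<kappa> * norm v powr \<alpha> \<le> ((-1) ^ p * (LINT \<xi>|riesz \<alpha>. cos_rem p (\<xi> \<bullet> e))) * norm v powr \<alpha>"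
      using unit[OF e(1)] by (intro mult_right_mono) auto
    also have "\<dots> = (-1) ^ p * (LINT \<xi>|riesz \<alpha>. cos_rem p (norm v * (\<xi> \<bullet> e)))"
      by (simp add: integral_cos_rem_scale)
    finally show ?thesis by (simp only: e(2))
  qed
  moreover have "0 < \<kappa>" using c by (simp add: \<kappa>_def)
  ultimately show ?thesis by blast
qed

text \<open>  The separate cosines are not integrable against the weight, but their Taylor remainders are, and each of
  them is a rescaling of the first one.\<close>

lemma integral_Re_diff_kernel:
  assumes "2 * p \<le> Suc k"
  shows "(LINT \<xi>|(riesz \<alpha> :: 'a::euclidean_space measure). Re (diff_kernel k (\<xi> \<bullet> v))) =
    forward_diff k (\<lambda>t. t powr \<alpha>) 0 * (LINT \<xi>|(riesz \<alpha> :: 'a measure). cos_rem p (\<xi> \<bullet> v))"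
proof -
  have Re_term: "Re (of_nat n * (-1) ^ j * exp (- \<i> * complex_of_real t)) = real n * (-1) ^ j * cos t" for n j t
  proof -
    have "of_nat n * (-1) ^ j * exp (- \<i> * complex_of_real t) = complex_of_real (real n * (-1) ^ j) * exp (- \<i> * complex_of_real t)"
      by simp
    moreover have "Re (complex_of_real c * z) = c * Re z" for c z
      by simp
    ultimately show ?thesis by (simp only:) (simp add: Re_exp)
  qed
  have "Re (diff_kernel k s) = (\<Sum>m\<le>k. real (k choose m) * (-1) ^ (k - m) * cos_rem p (real m * s))" for s
    unfolding diff_kernel_eq_sum Re_sum Re_term by (rule binomial_cos_eq_cos_rem[OF assms])
  moreover have "integrable (riesz \<alpha>) (\<lambda>\<xi>::'a. cos_rem p (real m * (\<xi> \<bullet> v)))" for m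
    using integrable_cos_rem[of "real m *\<^sub>R v"] by simp
  ultimately have "(LINT \<xi>|(riesz \<alpha> :: 'a measure). Re (diff_kernel k (\<xi> \<bullet> v))) =
      (\<Sum>m\<le>k. real (k choose m) * (-1) ^ (k - m) * (LINT \<xi>|(riesz \<alpha> :: 'a measure). cos_rem p (real m * (\<xi> \<bullet> v))))"
    by (simp add: Bochner_Integration.integral_sum)
  also have "\<dots> = forward_diff k (\<lambda>t. t powr \<alpha>) 0 * (LINT \<xi>|(riesz \<alpha> :: 'a measure). cos_rem p (\<xi> \<bullet> v))"
    by (simp add: integral_cos_rem_scale forward_diff_def sum_distrib_left mult_ac)
  finally show ?thesis .
qed

end

section \<open>Control of moments by the distance\<close>

text \<open>  The contraction \<open>L\<close> selects the part of the Fourier transform that enters the seminorm, and \<open>q\<close> is an order to which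
  \<open>L\<close> of the difference kernel vanishes at \<open>0\<close>.  It is \<open>k\<close> in general, but \<open>k + 1\<close> for the real part when \<open>k\<close> is odd.  The Taylor
  order \<open>p\<close> is determined by \<open>\<alpha>\<close>; its existence excludes even integers.\<close>

locale fourier_difference_metric =
  fixes L :: "complex \<Rightarrow> 'b::{real_normed_field, banach, second_countable_topology}"
    and k p :: nat and \<alpha> \<beta> q C :: real
  assumes L: "bounded_linear L" "\<And>z. norm (L z) \<le> norm z" "\<And>z. \<bar>Re z\<bar> \<le> norm (L z)"
    and k: "0 < k"
    and \<alpha>: "0 < \<alpha>" "\<alpha> < q" "\<And>j. j < k \<Longrightarrow> \<alpha> \<noteq> real j"
    and \<beta>: "0 < \<beta>" "\<beta> \<le> \<alpha>" "\<beta> \<le> 1"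
    and kernel: "\<And>s. norm (L (diff_kernel k s)) \<le> C * min (\<bar>s\<bar> powr q) (\<bar>s\<bar> powr 0)" and C: "0 \<le> C"
    and p: "0 < p" "2 * real p - 2 < \<alpha>" "\<alpha> < 2 * real p" "2 * p \<le> Suc k"
begin

definition total_dist :: "'a::euclidean_space measure \<Rightarrow> 'a measure \<Rightarrow> ennreal" where
  "total_dist \<mu> \<nu> = fourier_dist \<beta> \<mu> \<nu> + diff_norm \<alpha> k (\<lambda>\<xi>. L (fourier \<mu> \<xi> - fourier \<nu> \<xi>))"

definition L_diff :: "'a::euclidean_space measure \<Rightarrow> 'a \<Rightarrow> 'b" where
  "L_diff \<mu> \<xi> = L (fdiff k \<xi> (fourier \<mu>))"

lemma continuous_L: "continuous_on A L"
  using L(1) by (rule linear_continuous_on)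

lemma borel_measurable_L [measurable]: "L \<in> borel_measurable borel"
  using continuous_L by (rule borel_measurable_continuous_onI)

lemma L_minus: "L (a - b) = L a - L b"
  using L(1) by (simp add: bounded_linear.linear linear_diff)

lemma prob_moment_D:
  assumes "\<mu> \<in> prob_moment \<alpha>"
  shows "prob_space \<mu>" "sets \<mu> = sets borel" "integrable \<mu> (\<lambda>v. norm v powr \<alpha>)"
  using assms by (auto simp: prob_moment_def)

lemma borel_measurable_fdiff_fourier:
  assumes "\<mu> \<in> prob_moment \<alpha>"
  shows "(\<lambda>\<xi>. fdiff k \<xi> (fourier \<mu>)) \<in> borel_measurable borel"
proof -
  note borel_measurable_fourier[OF prob_moment_D(1,2)[OF assms], measurable]
  show ?thesis unfolding fdiff_def by measurable
qed

lemma borel_measurable_L_diff: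
  "\<mu> \<in> prob_moment \<alpha> \<Longrightarrow> L_diff \<mu> \<in> borel_measurable borel"
  unfolding L_diff_def[abs_def] using borel_measurable_fdiff_fourier by measurable

lemma diff_norm_eq:
  fixes \<mu> \<nu> :: "'a::euclidean_space measure"
  assumes "\<mu> \<in> prob_moment \<alpha>" "\<nu> \<in> prob_moment \<alpha>"
  shows "diff_norm \<alpha> k (\<lambda>\<xi>. L (fourier \<mu> \<xi> - fourier \<nu> \<xi>)) =
    (\<integral>\<^sup>+\<xi>. ennreal (norm (L_diff \<mu> \<xi> - L_diff \<nu> \<xi>)) \<partial>riesz \<alpha>)"
proof -
  note assms[THEN borel_measurable_L_diff, measurable]
  have "(\<integral>\<^sup>+\<xi>. ennreal (norm (L_diff \<mu> \<xi> - L_diff \<nu> \<xi>)) \<partial>riesz \<alpha>) =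
      (\<integral>\<^sup>+\<xi>. ennreal (1 / norm \<xi> powr (real DIM('a) + \<alpha>)) * ennreal (norm (L_diff \<mu> \<xi> - L_diff \<nu> \<xi>)) \<partial>lborel)"
    by (rule nn_integral_riesz) measurable
  then show ?thesis
    by (simp add: diff_norm_def fdiff_bounded_linear[OF L(1)] fdiff_diff L_diff_def L_minus
        ennreal_mult'[symmetric])
qed

lemma nn_integral_kernel_finite:
  fixes \<mu> :: "'a::euclidean_space measure"
  assumes "\<mu> \<in> prob_moment \<alpha>"
  shows "(\<integral>\<^sup>+v. \<integral>\<^sup>+\<xi>. ennreal (norm (L (diff_kernel k (\<xi> \<bullet> v)))) \<partial>riesz \<alpha> \<partial>\<mu>) < \<infinity>"
proof -
  note \<mu> = prob_moment_D[OF assms]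
  define K where "K = (\<integral>\<^sup>+\<xi>. ennreal (min (norm \<xi> powr q) (norm \<xi> powr 0)) \<partial>(riesz \<alpha> :: 'a measure))"
  have K: "K < \<infinity>" unfolding K_def using \<alpha> by (intro riesz_min_powr_finite) auto
  have [measurable]: "(\<lambda>v. norm v powr \<alpha>) \<in> borel_measurable \<mu>"
    using \<mu>(3) by simp
  have "(\<integral>\<^sup>+\<xi>. ennreal (norm (L (diff_kernel k (\<xi> \<bullet> v)))) \<partial>riesz \<alpha>) \<le> ennreal (C * norm v powr \<alpha>) * K" for v :: 'a
    using nn_integral_riesz_growth[where b=0 and a=q and C=C and f="\<lambda>s. norm (L (diff_kernel k s))" and v=v and \<alpha>=\<alpha>] \<alpha> C kernel
    by (simp add: K_def)
  then have "(\<integral>\<^sup>+v. \<integral>\<^sup>+\<xi>. ennreal (norm (L (diff_kernel k (\<xi> \<bullet> v)))) \<partial>riesz \<alpha> \<partial>\<mu>)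
      \<le> (\<integral>\<^sup>+v. ennreal (C * norm v powr \<alpha>) * K \<partial>\<mu>)"
    by (intro nn_integral_mono)
  also have "\<dots> = (\<integral>\<^sup>+v. ennreal (C * norm v powr \<alpha>) \<partial>\<mu>) * K"
    by (intro nn_integral_multc) simp
  also have "(\<integral>\<^sup>+v. ennreal (C * norm v powr \<alpha>) \<partial>\<mu>) = ennreal (LINT v|\<mu>. C * norm v powr \<alpha>)"
    using \<mu> C by (intro nn_integral_eq_integral integrable_mult_right) auto
  also have "\<dots> * K < \<infinity>"
    using K by (simp add: ennreal_mult_less_top)
  finally show ?thesis .
qed

lemma pair_sigma_finite_riesz:
  assumes "\<mu> \<in> prob_moment \<alpha>"
  shows "pair_sigma_finite (riesz \<alpha>) \<mu>"
proof -
  interpret prob_space \<mu> using prob_moment_D(1)[OF assms] .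
  show ?thesis
    by (intro pair_sigma_finite.intro sigma_finite_riesz sigma_finite_measure_axioms)
qed

lemma nn_integral_L_diff_finite:
  fixes \<mu> :: "'a::euclidean_space measure"
  assumes "\<mu> \<in> prob_moment \<alpha>"
  shows "(\<integral>\<^sup>+\<xi>. ennreal (norm (L_diff \<mu> \<xi>)) \<partial>riesz \<alpha>) < \<infinity>"
proof -
  note \<mu> = prob_moment_D[OF assms]
  interpret pair_sigma_finite "riesz \<alpha> :: 'a measure" \<mu> using assms by (rule pair_sigma_finite_riesz)
  note \<mu>(2)[measurable_cong]
  have "ennreal (norm (L_diff \<mu> \<xi>)) \<le> (\<integral>\<^sup>+v. ennreal (norm (L (diff_kernel k (\<xi> \<bullet> v)))) \<partial>\<mu>)" for \<xi>
  proof -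
    have i: "integrable \<mu> (\<lambda>v. diff_kernel k (\<xi> \<bullet> v))"
      by (intro integrable_bounded_borel[OF \<mu>(1,2), where B="2 ^ k"]) (auto intro: norm_diff_kernel_le)
    have iL: "integrable \<mu> (\<lambda>v. L (diff_kernel k (\<xi> \<bullet> v)))"
      by (rule integrable_bounded_linear[OF L(1) i])
    have "L_diff \<mu> \<xi> = (LINT v|\<mu>. L (diff_kernel k (\<xi> \<bullet> v)))"
      unfolding L_diff_def fdiff_fourier[OF \<mu>(1,2)] by (rule integral_bounded_linear[OF L(1) i, symmetric])
    then have "norm (L_diff \<mu> \<xi>) \<le> (LINT v|\<mu>. norm (L (diff_kernel k (\<xi> \<bullet> v))))"
      by (metis integral_norm_bound)
    then show ?thesis
      using nn_integral_eq_integral[OF integrable_norm[OF iL]] by (simp add: ennreal_leI)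
  qed
  then have "(\<integral>\<^sup>+\<xi>. ennreal (norm (L_diff \<mu> \<xi>)) \<partial>riesz \<alpha>) \<le>
      (\<integral>\<^sup>+\<xi>. \<integral>\<^sup>+v. ennreal (norm (L (diff_kernel k (\<xi> \<bullet> v)))) \<partial>\<mu> \<partial>riesz \<alpha>)"
    by (intro nn_integral_mono)
  also have "\<dots> = (\<integral>\<^sup>+v. \<integral>\<^sup>+\<xi>. ennreal (norm (L (diff_kernel k (\<xi> \<bullet> v)))) \<partial>riesz \<alpha> \<partial>\<mu>)"
    by (rule Fubini'[symmetric]) measurable
  also have "\<dots> < \<infinity>" by (rule nn_integral_kernel_finite[OF assms])
  finally show ?thesis .
qed

lemma integrable_L_diff:
  assumes "\<mu> \<in> prob_moment \<alpha>"
  shows "integrable (riesz \<alpha>) (L_diff \<mu>)"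
  using nn_integral_L_diff_finite[OF assms] borel_measurable_L_diff[OF assms]
  by (intro integrableI_bounded) auto

text \<open>  Fubini's theorem applies because \<open>\<bar>Re z\<bar> \<le> norm (L z)\<close>: the real part inherits absolute integrability from the
  part observed by \<open>L\<close>.\<close>

lemma integral_Re_fdiff:
  fixes \<mu> :: "'a::euclidean_space measure"
  assumes "\<mu> \<in> prob_moment \<alpha>"
  shows "(LINT \<xi>|riesz \<alpha>. Re (fdiff k \<xi> (fourier \<mu>))) =
      forward_diff k (\<lambda>t. t powr \<alpha>) 0 * (LINT v|\<mu>. LINT \<xi>|riesz \<alpha>. cos_rem p (\<xi> \<bullet> v))"
    and "integrable \<mu> (\<lambda>v. LINT \<xi>|riesz \<alpha>. cos_rem p (\<xi> \<bullet> v))"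
proof -
  note \<mu> = prob_moment_D[OF assms]
  interpret pair_sigma_finite "riesz \<alpha> :: 'a measure" \<mu> using assms by (rule pair_sigma_finite_riesz)
  note \<mu>(2)[measurable_cong]
  let ?f = "\<lambda>(\<xi>, v). Re (diff_kernel k (\<xi> \<bullet> v))"
  have meas: "?f \<in> borel_measurable (riesz \<alpha> \<Otimes>\<^sub>M \<mu>)" by measurable
  have "(\<integral>\<^sup>+z. ennreal (norm (?f z)) \<partial>(riesz \<alpha> \<Otimes>\<^sub>M \<mu>)) =
      (\<integral>\<^sup>+v. \<integral>\<^sup>+\<xi>. ennreal (norm (Re (diff_kernel k (\<xi> \<bullet> v)))) \<partial>riesz \<alpha> \<partial>\<mu>)"
    by (subst nn_integral_snd[symmetric]) auto
  also have "\<dots> \<le> (\<integral>\<^sup>+v. \<integral>\<^sup>+\<xi>. ennreal (norm (L (diff_kernel k (\<xi> \<bullet> v)))) \<partial>riesz \<alpha> \<partial>\<mu>)"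
    by (intro nn_integral_mono ennreal_leI) (simp add: L)
  also have "\<dots> < \<infinity>" by (rule nn_integral_kernel_finite[OF assms])
  finally have int: "integrable (riesz \<alpha> \<Otimes>\<^sub>M \<mu>) ?f"
    by (intro integrableI_bounded meas)
  have S: "forward_diff k (\<lambda>t. t powr \<alpha>) 0 \<noteq> 0"
    using \<alpha> k by (intro forward_diff_powr_nonzero) auto
  have eq: "(LINT \<xi>|riesz \<alpha>. Re (diff_kernel k (\<xi> \<bullet> v))) =
      forward_diff k (\<lambda>t. t powr \<alpha>) 0 * (LINT \<xi>|riesz \<alpha>. cos_rem p (\<xi> \<bullet> v))" for v :: 'a
    using p by (intro integral_Re_diff_kernel) auto
  have "integrable \<mu> (\<lambda>v. LINT \<xi>|riesz \<alpha>. Re (diff_kernel k (\<xi> \<bullet> v)))"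
    using integrable_snd[OF int] by simp
  then show "integrable \<mu> (\<lambda>v. LINT \<xi>|riesz \<alpha>. cos_rem p (\<xi> \<bullet> v))"
    unfolding eq using S by simp
  have "Re (fdiff k \<xi> (fourier \<mu>)) = (LINT v|\<mu>. Re (diff_kernel k (\<xi> \<bullet> v)))" for \<xi>
    unfolding fdiff_fourier[OF \<mu>(1,2)]
    by (intro integral_Re[symmetric] integrable_bounded_borel[OF \<mu>(1,2), where B="2 ^ k"]) (auto intro: norm_diff_kernel_le)
  then have "(LINT \<xi>|riesz \<alpha>. Re (fdiff k \<xi> (fourier \<mu>))) = (LINT \<xi>|riesz \<alpha>. LINT v|\<mu>. Re (diff_kernel k (\<xi> \<bullet> v)))"
    by simp
  also have "\<dots> = (LINT v|\<mu>. LINT \<xi>|riesz \<alpha>. Re (diff_kernel k (\<xi> \<bullet> v)))"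
    by (rule Fubini_integral[symmetric, OF int])
  finally show "(LINT \<xi>|riesz \<alpha>. Re (fdiff k \<xi> (fourier \<mu>))) =
      forward_diff k (\<lambda>t. t powr \<alpha>) 0 * (LINT v|\<mu>. LINT \<xi>|riesz \<alpha>. cos_rem p (\<xi> \<bullet> v))"
    unfolding eq by simp
qed

text \<open>  Integrating the identity for the real part of the kernel over \<open>\<mu>\<close> shows that, up to a fixed sign and factor, the
  integral of \<open>Re (fdiff k \<xi> (fourier \<mu>))\<close> dominates the moment of \<open>\<mu>\<close>.  This integral is linear in \<open>\<mu>\<close>, and its values for \<open>\<mu>\<close>
  and \<open>\<nu>\<close> differ by at most the seminorm of the difference.\<close>

lemma moment_bound:
  "\<exists>\<kappa>>0. \<exists>T. \<forall>\<mu>\<in>prob_moment \<alpha>. \<forall>\<nu>\<in>prob_moment \<alpha> :: 'a::euclidean_space measure set.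
     \<kappa> * (LINT v|\<mu>. norm v powr \<alpha>) \<le> T \<nu> + enn2real (\<integral>\<^sup>+\<xi>. ennreal (norm (L_diff \<mu> \<xi> - L_diff \<nu> \<xi>)) \<partial>riesz \<alpha>)"
proof -
  define S where "S = forward_diff k (\<lambda>t. t powr \<alpha>) 0"
  have S: "S \<noteq> 0"
    unfolding S_def using \<alpha> k by (intro forward_diff_powr_nonzero) auto
  define N where "N v = (LINT \<xi>|(riesz \<alpha> :: 'a measure). cos_rem p (\<xi> \<bullet> v))" for v
  obtain \<kappa> where \<kappa>: "0 < \<kappa>" "\<And>v. \<kappa> * norm v powr \<alpha> \<le> (-1) ^ p * N v"
    using integral_cos_rem_lower[of p \<alpha>, where 'a='a] p unfolding N_def by blast
  define T where "T \<mu> = (LINT \<xi>|riesz \<alpha>. Re (fdiff k \<xi> (fourier \<mu>)))" for \<mu> :: "'a measure"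
  \<comment> \<open>The sign that makes \<open>S * N v\<close> nonnegative.\<close>
  define \<sigma> where "\<sigma> = sgn S * (-1) ^ p"
  have \<sigma>: "\<bar>\<sigma>\<bar> = 1" using S by (simp add: \<sigma>_def abs_mult abs_sgn_eq)
  have "\<bar>S\<bar> * \<kappa> * (LINT v|\<mu>. norm v powr \<alpha>) \<le> \<sigma> * T \<nu> + enn2real (\<integral>\<^sup>+\<xi>. ennreal (norm (L_diff \<mu> \<xi> - L_diff \<nu> \<xi>)) \<partial>riesz \<alpha>)"
    if \<mu>: "\<mu> \<in> prob_moment \<alpha>" and \<nu>: "\<nu> \<in> prob_moment \<alpha>" for \<mu> \<nu> :: "'a measure"
  proof -
    note borel_measurable_fdiff_fourier[OF \<mu>, measurable] borel_measurable_fdiff_fourier[OF \<nu>, measurable]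
    have iRe: "integrable (riesz \<alpha>) (\<lambda>\<xi>. Re (fdiff k \<xi> (fourier M)))" if "M \<in> prob_moment \<alpha>" for M :: "'a measure"
    proof (rule Bochner_Integration.integrable_bound[OF integrable_L_diff[OF that]])
      show "AE \<xi> in riesz \<alpha>. norm (Re (fdiff k \<xi> (fourier M))) \<le> norm (L_diff M \<xi>)"
        by (simp add: L_diff_def L)
    qed (use borel_measurable_fdiff_fourier[OF that] in simp)
    have "T \<mu> = S * (LINT v|\<mu>. N v)"
      unfolding T_def S_def N_def by (rule integral_Re_fdiff[OF \<mu>])
    then have "\<sigma> * T \<mu> = \<bar>S\<bar> * (LINT v|\<mu>. (-1) ^ p * N v)"
      by (simp add: \<sigma>_def abs_sgn mult_ac)
    moreover have "(LINT v|\<mu>. \<kappa> * norm v powr \<alpha>) \<le> (LINT v|\<mu>. (-1) ^ p * N v)"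
      using \<kappa> prob_moment_D(3)[OF \<mu>] integral_Re_fdiff(2)[OF \<mu>]
      by (intro integral_mono integrable_mult_right) (auto simp: N_def)
    ultimately have 1: "\<bar>S\<bar> * \<kappa> * (LINT v|\<mu>. norm v powr \<alpha>) \<le> \<sigma> * T \<mu>"
      by (simp add: mult.assoc mult_left_mono)
    have iL: "integrable (riesz \<alpha>) (\<lambda>\<xi>. L_diff \<mu> \<xi> - L_diff \<nu> \<xi>)"
      using integrable_L_diff[OF \<mu>] integrable_L_diff[OF \<nu>] by simp
    have "\<sigma> * T \<mu> - \<sigma> * T \<nu> \<le> \<bar>T \<mu> - T \<nu>\<bar>"
      using \<sigma> by (metis abs_ge_self abs_mult mult_1 right_diff_distrib)
    also have "T \<mu> - T \<nu> = (LINT \<xi>|riesz \<alpha>. Re (fdiff k \<xi> (fourier \<mu>) - fdiff k \<xi> (fourier \<nu>)))"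
      unfolding T_def using iRe[OF \<mu>] iRe[OF \<nu>] by simp
    also have "\<bar>\<dots>\<bar> \<le> (LINT \<xi>|riesz \<alpha>. norm (L_diff \<mu> \<xi> - L_diff \<nu> \<xi>))"
    proof (rule order.trans[OF integral_abs_bound integral_mono])
      show "\<bar>Re (fdiff k \<xi> (fourier \<mu>) - fdiff k \<xi> (fourier \<nu>))\<bar> \<le> norm (L_diff \<mu> \<xi> - L_diff \<nu> \<xi>)" for \<xi>
        unfolding L_diff_def L_minus[symmetric] by (rule L(3))
    qed (use iRe[OF \<mu>] iRe[OF \<nu>] iL in auto)
    also have "\<dots> = enn2real (\<integral>\<^sup>+\<xi>. ennreal (norm (L_diff \<mu> \<xi> - L_diff \<nu> \<xi>)) \<partial>riesz \<alpha>)"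
      using nn_integral_eq_integral[OF integrable_norm[OF iL]] by (simp add: enn2real_ennreal integral_nonneg_AE)
    finally show ?thesis using 1 by linarith
  qed
  moreover have "0 < \<bar>S\<bar> * \<kappa>" using S \<kappa> by simp
  ultimately show ?thesis by (intro exI[of _ "\<bar>S\<bar> * \<kappa>"] conjI exI[of _ "\<lambda>\<nu>. \<sigma> * T \<nu>"]) auto
qed

end

section \<open>Completeness\<close>

lemma norm_exp_minus_one_le_powr:
  assumes "0 < \<beta>" "\<beta> \<le> 1"
  shows "norm (exp (- \<i> * complex_of_real s) - 1) \<le> 2 * \<bar>s\<bar> powr \<beta>"
proof (cases "\<bar>s\<bar> \<le> 1")
  case True
  have "\<bar>s\<bar> \<le> \<bar>s\<bar> powr \<beta>"
    using powr_mono'[of \<beta> 1 "\<bar>s\<bar>"] assms True by simp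
  then show ?thesis using norm_exp_minus_one_le(1)[of s] by linarith
next
  case False
  then have "1 \<le> \<bar>s\<bar> powr \<beta>" using assms by (intro ge_one_powr_ge_zero) auto
  then show ?thesis using norm_exp_minus_one_le(2)[of s] by linarith
qed

lemma norm_fourier_minus_one_le:
  fixes \<mu> :: "'a::euclidean_space measure"
  assumes "\<mu> \<in> prob_moment \<alpha>" "0 < \<beta>" "\<beta> \<le> \<alpha>" "\<beta> \<le> 1"
  shows "norm (fourier \<mu> \<xi> - 1) \<le> 2 * (1 + (LINT v|\<mu>. norm v powr \<alpha>)) * norm \<xi> powr \<beta>"
proof -
  have \<mu>: "prob_space \<mu>" "sets \<mu> = sets borel" "integrable \<mu> (\<lambda>v. norm v powr \<alpha>)"
    using assms(1) by (auto simp: prob_moment_def)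
  interpret prob_space \<mu> by fact
  have i: "integrable \<mu> (\<lambda>v. exp (- \<i> * complex_of_real (\<xi> \<bullet> v)))"
    by (intro integrable_bounded_borel[OF \<mu>(1,2), where B=1]) auto
  have "fourier \<mu> \<xi> - 1 = (LINT v|\<mu>. exp (- \<i> * complex_of_real (\<xi> \<bullet> v)) - 1)"
    unfolding fourier_def using i by (subst Bochner_Integration.integral_diff) (auto simp: prob_space)
  also have "norm \<dots> \<le> (LINT v|\<mu>. norm (exp (- \<i> * complex_of_real (\<xi> \<bullet> v)) - 1))"
    by (rule integral_norm_bound)
  also have "\<dots> \<le> (LINT v|\<mu>. 2 * norm \<xi> powr \<beta> * (1 + norm v powr \<alpha>))"
  proof (rule integral_mono)
    show "integrable \<mu> (\<lambda>v. norm (exp (- \<i> * complex_of_real (\<xi> \<bullet> v)) - 1))"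
      using i by simp
    show "integrable \<mu> (\<lambda>v. 2 * norm \<xi> powr \<beta> * (1 + norm v powr \<alpha>))"
      using \<mu> by simp
    fix v
    have "norm (exp (- \<i> * complex_of_real (\<xi> \<bullet> v)) - 1) \<le> 2 * \<bar>\<xi> \<bullet> v\<bar> powr \<beta>"
      using assms by (intro norm_exp_minus_one_le_powr) auto
    also have "\<dots> \<le> 2 * (norm \<xi> * norm v) powr \<beta>"
      using assms by (intro mult_left_mono powr_mono2 Cauchy_Schwarz_ineq2) auto
    also have "\<dots> = 2 * norm \<xi> powr \<beta> * norm v powr \<beta>"
      by (simp add: powr_mult)
    also have "\<dots> \<le> 2 * norm \<xi> powr \<beta> * (1 + norm v powr \<alpha>)"
    proof (intro mult_left_mono)
      show "norm v powr \<beta> \<le> 1 + norm v powr \<alpha>"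
      proof (cases "norm v \<le> 1")
        case True
        then have "norm v powr \<beta> \<le> 1" using assms by (intro powr_le1) auto
        then show ?thesis by (simp add: add_increasing2)
      next
        case False
        then have "norm v powr \<beta> \<le> norm v powr \<alpha>" using assms by (intro powr_mono) auto
        then show ?thesis by simp
      qed
    qed auto
    finally show "norm (exp (- \<i> * complex_of_real (\<xi> \<bullet> v)) - 1) \<le> 2 * norm \<xi> powr \<beta> * (1 + norm v powr \<alpha>)" .
  qed
  also have "\<dots> = 2 * norm \<xi> powr \<beta> * (1 + (LINT v|\<mu>. norm v powr \<alpha>))"
    using \<mu> by (simp add: prob_space)
  finally show ?thesis by (simp add: algebra_simps)
qed

lemma fourier_zero: "prob_space \<mu> \<Longrightarrow> fourier \<mu> 0 = 1"
  by (simp add: fourier_def prob_space.prob_space)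

context fourier_difference_metric
begin

lemma fourier_dist_finite:
  assumes "\<mu> \<in> prob_moment \<alpha>" "\<nu> \<in> prob_moment \<alpha>"
  shows "fourier_dist \<beta> \<mu> \<nu> < \<infinity>"
proof -
  define A where "A M = 2 * (1 + (LINT v|M. norm v powr \<alpha>))" for M :: "'a measure"
  have "fourier_dist \<beta> \<mu> \<nu> \<le> ennreal (A \<mu> + A \<nu>)"
    unfolding fourier_dist_def
  proof (rule SUP_least)
    fix \<xi> :: 'a assume "\<xi> \<in> - {0}"
    then have pos: "0 < norm \<xi> powr \<beta>" by simp
    have "norm (fourier \<mu> \<xi> - fourier \<nu> \<xi>) \<le> norm (fourier \<mu> \<xi> - 1) + norm (fourier \<nu> \<xi> - 1)"
      using norm_triangle_ineq4[of "fourier \<mu> \<xi> - 1" "fourier \<nu> \<xi> - 1"] by simp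
    also have "\<dots> \<le> (A \<mu> + A \<nu>) * norm \<xi> powr \<beta>"
      using norm_fourier_minus_one_le[OF assms(1) \<beta>, of \<xi>] norm_fourier_minus_one_le[OF assms(2) \<beta>, of \<xi>]
      by (simp add: A_def distrib_right)
    finally show "ennreal (norm (fourier \<mu> \<xi> - fourier \<nu> \<xi>) / norm \<xi> powr \<beta>) \<le> ennreal (A \<mu> + A \<nu>)"
      using pos by (intro ennreal_leI) (simp add: divide_le_eq)
  qed
  also have "\<dots> < \<infinity>" by simp
  finally show ?thesis .
qed

lemma total_dist_eq:
  assumes "\<mu> \<in> prob_moment \<alpha>" "\<nu> \<in> prob_moment \<alpha>"
  shows "total_dist \<mu> \<nu> = fourier_dist \<beta> \<mu> \<nu> + (\<integral>\<^sup>+\<xi>. ennreal (norm (L_diff \<mu> \<xi> - L_diff \<nu> \<xi>)) \<partial>riesz \<alpha>)"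
  unfolding total_dist_def using diff_norm_eq[OF assms] by simp

lemma total_dist_finite:
  assumes "\<mu> \<in> prob_moment \<alpha>" "\<nu> \<in> prob_moment \<alpha>"
  shows "total_dist \<mu> \<nu> < \<infinity>"
proof -
  have "integrable (riesz \<alpha>) (\<lambda>\<xi>. L_diff \<mu> \<xi> - L_diff \<nu> \<xi>)"
    using assms[THEN integrable_L_diff] by simp
  then have "(\<integral>\<^sup>+\<xi>. ennreal (norm (L_diff \<mu> \<xi> - L_diff \<nu> \<xi>)) \<partial>riesz \<alpha>) < \<infinity>"
    by (simp add: integrable_iff_bounded)
  then show ?thesis
    using fourier_dist_finite[OF assms] by (simp add: total_dist_eq[OF assms])
qed

lemma total_dist_commute: "total_dist \<mu> \<nu> = total_dist \<nu> \<mu>"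
proof -
  have "norm (fdiff k \<xi> (\<lambda>\<xi>. L (fourier \<mu> \<xi> - fourier \<nu> \<xi>))) = norm (fdiff k \<xi> (\<lambda>\<xi>. L (fourier \<nu> \<xi> - fourier \<mu> \<xi>)))" for \<xi>
    by (simp add: fdiff_bounded_linear[OF L(1)] fdiff_diff L_minus norm_minus_commute)
  then show ?thesis
    by (simp add: total_dist_def fourier_dist_def diff_norm_def norm_minus_commute)
qed

lemma total_dist_self: "total_dist \<mu> \<mu> = 0" for \<mu> :: "'a::euclidean_space measure"
proof -
  have "fdiff k \<xi> (\<lambda>\<xi>. L (fourier \<mu> \<xi> - fourier \<mu> \<xi>)) = 0" for \<xi>
    using linear_0[OF bounded_linear.linear[OF L(1)]] by (simp add: fdiff_def)
  moreover have "(SUP \<xi>\<in>A. 0 :: ennreal) = 0" for A :: "'a set"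
    by (metis SUP_bot bot_ennreal)
  ultimately show ?thesis
    by (simp add: total_dist_def fourier_dist_def diff_norm_def)
qed

lemma total_dist_zero_imp_eq:
  assumes \<mu>: "\<mu> \<in> prob_moment \<alpha>" and \<nu>: "\<nu> \<in> prob_moment \<alpha>" and "total_dist \<mu> \<nu> = 0"
  shows "\<mu> = \<nu>"
proof (rule fourier_unique)
  fix \<xi>
  show "fourier \<mu> \<xi> = fourier \<nu> \<xi>"
  proof (cases "\<xi> = 0")
    case True
    then show ?thesis
      using fourier_zero[OF prob_moment_D(1)[OF \<mu>]] fourier_zero[OF prob_moment_D(1)[OF \<nu>]] by simp
  next
    case False
    have "ennreal (norm (fourier \<mu> \<xi> - fourier \<nu> \<xi>) / norm \<xi> powr \<beta>) \<le> fourier_dist \<beta> \<mu> \<nu>"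
      unfolding fourier_dist_def using False by (intro SUP_upper) simp
    also have "\<dots> = 0" using assms(3) by (simp add: total_dist_def)
    finally have "norm (fourier \<mu> \<xi> - fourier \<nu> \<xi>) / norm \<xi> powr \<beta> \<le> 0"
      by (simp add: ennreal_eq_0_iff)
    moreover have "0 < norm \<xi> powr \<beta>" using False by simp
    ultimately show ?thesis by (simp add: divide_le_0_iff)
  qed
qed (use prob_moment_D \<mu> \<nu> in auto)

lemma total_dist_triangle:
  assumes \<mu>: "\<mu> \<in> prob_moment \<alpha>" and \<nu>: "\<nu> \<in> prob_moment \<alpha>" and \<rho>: "\<rho> \<in> prob_moment \<alpha>"
  shows "total_dist \<mu> \<rho> \<le> total_dist \<mu> \<nu> + total_dist \<nu> \<rho>"
proof -
  note assms[THEN borel_measurable_L_diff, measurable]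
  have 1: "fourier_dist \<beta> \<mu> \<rho> \<le> fourier_dist \<beta> \<mu> \<nu> + fourier_dist \<beta> \<nu> \<rho>"
    unfolding fourier_dist_def[of \<beta> \<mu> \<rho>]
  proof (rule SUP_least)
    fix \<xi> :: 'a assume \<xi>: "\<xi> \<in> - {0}"
    have "norm (fourier \<mu> \<xi> - fourier \<rho> \<xi>) \<le> norm (fourier \<mu> \<xi> - fourier \<nu> \<xi>) + norm (fourier \<nu> \<xi> - fourier \<rho> \<xi>)"
      using norm_triangle_ineq[of "fourier \<mu> \<xi> - fourier \<nu> \<xi>" "fourier \<nu> \<xi> - fourier \<rho> \<xi>"] by simp
    then have "ennreal (norm (fourier \<mu> \<xi> - fourier \<rho> \<xi>) / norm \<xi> powr \<beta>) \<le>
        ennreal (norm (fourier \<mu> \<xi> - fourier \<nu> \<xi>) / norm \<xi> powr \<beta>) + ennreal (norm (fourier \<nu> \<xi> - fourier \<rho> \<xi>) / norm \<xi> powr \<beta>)"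
      by (simp add: ennreal_plus[symmetric] add_divide_distrib[symmetric] divide_right_mono ennreal_leI del: ennreal_plus)
    also have "\<dots> \<le> fourier_dist \<beta> \<mu> \<nu> + fourier_dist \<beta> \<nu> \<rho>"
      unfolding fourier_dist_def using \<xi> by (intro add_mono SUP_upper)
    finally show "ennreal (norm (fourier \<mu> \<xi> - fourier \<rho> \<xi>) / norm \<xi> powr \<beta>) \<le> fourier_dist \<beta> \<mu> \<nu> + fourier_dist \<beta> \<nu> \<rho>" .
  qed
  have "norm (L_diff \<mu> \<xi> - L_diff \<rho> \<xi>) \<le> norm (L_diff \<mu> \<xi> - L_diff \<nu> \<xi>) + norm (L_diff \<nu> \<xi> - L_diff \<rho> \<xi>)" for \<xi>
    using norm_triangle_ineq[of "L_diff \<mu> \<xi> - L_diff \<nu> \<xi>" "L_diff \<nu> \<xi> - L_diff \<rho> \<xi>"] by simp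
  then have "(\<integral>\<^sup>+\<xi>. ennreal (norm (L_diff \<mu> \<xi> - L_diff \<rho> \<xi>)) \<partial>riesz \<alpha>) \<le>
     (\<integral>\<^sup>+\<xi>. ennreal (norm (L_diff \<mu> \<xi> - L_diff \<nu> \<xi>)) + ennreal (norm (L_diff \<nu> \<xi> - L_diff \<rho> \<xi>)) \<partial>riesz \<alpha>)"
    by (intro nn_integral_mono) (simp add: ennreal_plus[symmetric] ennreal_leI del: ennreal_plus)
  also have "\<dots> = (\<integral>\<^sup>+\<xi>. ennreal (norm (L_diff \<mu> \<xi> - L_diff \<nu> \<xi>)) \<partial>riesz \<alpha>) +
      (\<integral>\<^sup>+\<xi>. ennreal (norm (L_diff \<nu> \<xi> - L_diff \<rho> \<xi>)) \<partial>riesz \<alpha>)"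
    by (intro nn_integral_add) measurable
  finally have 2: "(\<integral>\<^sup>+\<xi>. ennreal (norm (L_diff \<mu> \<xi> - L_diff \<rho> \<xi>)) \<partial>riesz \<alpha>) \<le>
      (\<integral>\<^sup>+\<xi>. ennreal (norm (L_diff \<mu> \<xi> - L_diff \<nu> \<xi>)) \<partial>riesz \<alpha>) +
      (\<integral>\<^sup>+\<xi>. ennreal (norm (L_diff \<nu> \<xi> - L_diff \<rho> \<xi>)) \<partial>riesz \<alpha>)" .
  show ?thesis
    using add_mono[OF 1 2] by (simp add: total_dist_eq assms add_ac)
qed

lemma Metric_space_total_dist: "Metric_space (prob_moment \<alpha>) (\<lambda>\<mu> \<nu>. enn2real (total_dist \<mu> \<nu>))"
proof
  fix \<mu> \<nu> \<rho> :: "'a measure"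
  show "0 \<le> enn2real (total_dist \<mu> \<nu>)" by simp
  show "enn2real (total_dist \<mu> \<nu>) = enn2real (total_dist \<nu> \<mu>)" by (subst total_dist_commute) rule
  show "enn2real (total_dist \<mu> \<nu>) = 0 \<longleftrightarrow> \<mu> = \<nu>" if "\<mu> \<in> prob_moment \<alpha>" "\<nu> \<in> prob_moment \<alpha>"
    using total_dist_finite[OF that] total_dist_zero_imp_eq[OF that] total_dist_self by (auto simp: enn2real_eq_0_iff)
  show "enn2real (total_dist \<mu> \<rho>) \<le> enn2real (total_dist \<mu> \<nu>) + enn2real (total_dist \<nu> \<rho>)"
    if "\<mu> \<in> prob_moment \<alpha>" "\<nu> \<in> prob_moment \<alpha>" "\<rho> \<in> prob_moment \<alpha>"
  proof -
    have "enn2real (total_dist \<mu> \<rho>) \<le> enn2real (total_dist \<mu> \<nu> + total_dist \<nu> \<rho>)"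
      using total_dist_triangle[OF that] total_dist_finite that by (intro enn2real_mono) auto
    also have "\<dots> = enn2real (total_dist \<mu> \<nu>) + enn2real (total_dist \<nu> \<rho>)"
      using total_dist_finite that by (intro enn2real_plus) auto
    finally show ?thesis .
  qed
qed

text \<open>  Lower semicontinuity: for the supremum term by a limit for each \<open>\<xi>\<close>, for the seminorm by Fatou's lemma.
  Bounding the two terms separately accounts for the factor \<open>2\<close>.\<close>

lemma total_dist_le_of_fourier_limit:
  assumes \<mu>: "\<mu> \<in> prob_moment \<alpha>" and \<nu>: "\<And>n. \<nu> n \<in> prob_moment \<alpha>" and \<rho>: "\<rho> \<in> prob_moment \<alpha>"
    and lim: "\<And>\<xi>. (\<lambda>n. fourier (\<nu> n) \<xi>) \<longlonglongrightarrow> fourier \<rho> \<xi>"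
    and le: "eventually (\<lambda>n. total_dist \<mu> (\<nu> n) \<le> ennreal \<epsilon>) sequentially" and \<epsilon>: "0 \<le> \<epsilon>"
  shows "total_dist \<mu> \<rho> \<le> ennreal \<epsilon> + ennreal \<epsilon>"
proof -
  note \<mu>[THEN borel_measurable_L_diff, measurable] \<nu>[THEN borel_measurable_L_diff, measurable]
  have 1: "fourier_dist \<beta> \<mu> \<rho> \<le> ennreal \<epsilon>"
    unfolding fourier_dist_def
  proof (rule SUP_least)
    fix \<xi> :: 'a assume \<xi>: "\<xi> \<in> - {0}"
    have "norm (fourier \<mu> \<xi> - fourier \<rho> \<xi>) / norm \<xi> powr \<beta> \<le> \<epsilon>"
    proof (rule tendsto_upperbound)
      show "(\<lambda>n. norm (fourier \<mu> \<xi> - fourier (\<nu> n) \<xi>) / norm \<xi> powr \<beta>) \<longlonglongrightarrow> norm (fourier \<mu> \<xi> - fourier \<rho> \<xi>) / norm \<xi> powr \<beta>"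
        using \<xi> by (intro tendsto_intros lim) auto
      show "\<forall>\<^sub>F n in sequentially. norm (fourier \<mu> \<xi> - fourier (\<nu> n) \<xi>) / norm \<xi> powr \<beta> \<le> \<epsilon>"
        using le
      proof eventually_elim
        case (elim n)
        have "ennreal (norm (fourier \<mu> \<xi> - fourier (\<nu> n) \<xi>) / norm \<xi> powr \<beta>) \<le> fourier_dist \<beta> \<mu> (\<nu> n)"
          unfolding fourier_dist_def using \<xi> by (intro SUP_upper) simp
        also have "\<dots> \<le> total_dist \<mu> (\<nu> n)" by (simp add: total_dist_def)
        finally have "ennreal (norm (fourier \<mu> \<xi> - fourier (\<nu> n) \<xi>) / norm \<xi> powr \<beta>) \<le> ennreal \<epsilon>"
          using elim by (rule order.trans)
        then show ?case using \<epsilon> by simp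
      qed
    qed simp
    then show "ennreal (norm (fourier \<mu> \<xi> - fourier \<rho> \<xi>) / norm \<xi> powr \<beta>) \<le> ennreal \<epsilon>"
      by (rule ennreal_leI)
  qed
  have "(\<lambda>n. L_diff (\<nu> n) \<xi>) \<longlonglongrightarrow> L_diff \<rho> \<xi>" for \<xi>
    unfolding L_diff_def fdiff_def
    by (intro bounded_linear.tendsto[OF L(1)] tendsto_intros lim)
  then have "(\<lambda>n. ennreal (norm (L_diff \<mu> \<xi> - L_diff (\<nu> n) \<xi>))) \<longlonglongrightarrow> ennreal (norm (L_diff \<mu> \<xi> - L_diff \<rho> \<xi>))" for \<xi>
    by (intro tendsto_ennrealI tendsto_intros)
  then have "(\<integral>\<^sup>+\<xi>. ennreal (norm (L_diff \<mu> \<xi> - L_diff \<rho> \<xi>)) \<partial>riesz \<alpha>) =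
      (\<integral>\<^sup>+\<xi>. liminf (\<lambda>n. ennreal (norm (L_diff \<mu> \<xi> - L_diff (\<nu> n) \<xi>))) \<partial>riesz \<alpha>)"
    by (intro nn_integral_cong lim_imp_Liminf[symmetric]) auto
  also have "\<dots> \<le> liminf (\<lambda>n. \<integral>\<^sup>+\<xi>. ennreal (norm (L_diff \<mu> \<xi> - L_diff (\<nu> n) \<xi>)) \<partial>riesz \<alpha>)"
    by (intro nn_integral_liminf) measurable
  also have "\<dots> \<le> liminf (\<lambda>n. ennreal \<epsilon>)"
  proof (rule Liminf_mono)
    show "\<forall>\<^sub>F n in sequentially. (\<integral>\<^sup>+\<xi>. ennreal (norm (L_diff \<mu> \<xi> - L_diff (\<nu> n) \<xi>)) \<partial>riesz \<alpha>) \<le> ennreal \<epsilon>"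
      using le
    proof eventually_elim
      case (elim n)
      have "(\<integral>\<^sup>+\<xi>. ennreal (norm (L_diff \<mu> \<xi> - L_diff (\<nu> n) \<xi>)) \<partial>riesz \<alpha>) \<le> total_dist \<mu> (\<nu> n)"
        unfolding total_dist_eq[OF \<mu> \<nu>] by simp
      then show ?case using elim by (rule order.trans)
    qed
  qed
  also have "\<dots> = ennreal \<epsilon>" by (simp add: Liminf_const)
  finally show ?thesis
    using 1 by (simp only: total_dist_eq[OF \<mu> \<rho>] add_mono)
qed

lemma enn2real_total_dist_less_iff:
  assumes "\<mu> \<in> prob_moment \<alpha>" "\<nu> \<in> prob_moment \<alpha>" "0 < \<epsilon>"
  shows "enn2real (total_dist \<mu> \<nu>) < \<epsilon> \<longleftrightarrow> total_dist \<mu> \<nu> < ennreal \<epsilon>"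
  using total_dist_finite[OF assms(1,2)] assms(3) by (simp add: enn2real_less_iff less_top)

text \<open>  The moments of a Cauchy sequence are bounded, because from some index on its members are close to one fixed
  member.  The weak limit of a subsequence is then the limit of the whole sequence.\<close>

theorem complete_metric_total_dist:
  "complete_metric_on (prob_moment \<alpha> :: 'a::euclidean_space measure set) total_dist"
proof -
  interpret M: Metric_space "prob_moment \<alpha> :: 'a measure set" "\<lambda>\<mu> \<nu>. enn2real (total_dist \<mu> \<nu>)"
    by (rule Metric_space_total_dist)
  have "\<exists>\<nu>. limitin M.mtopology \<sigma> \<nu> sequentially" if "M.MCauchy \<sigma>" for \<sigma>
  proof -
    have \<sigma>: "\<sigma> n \<in> prob_moment \<alpha>" for n
      using that by (auto simp: M.MCauchy_def)
    have cauchy: "\<exists>N. \<forall>n\<ge>N. \<forall>n'\<ge>N. total_dist (\<sigma> n) (\<sigma> n') < ennreal \<epsilon>" if "0 < \<epsilon>" for \<epsilon>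
      using \<open>M.MCauchy \<sigma>\<close> that enn2real_total_dist_less_iff[OF \<sigma> \<sigma> that] unfolding M.MCauchy_def by metis
    obtain N0 where N0: "\<And>n. N0 \<le> n \<Longrightarrow> total_dist (\<sigma> n) (\<sigma> N0) < 1"
      using cauchy[of 1] by auto
    from moment_bound[where 'a='a] obtain \<kappa> T where \<kappa>: "0 < \<kappa>"
      and T: "\<forall>\<mu>\<in>prob_moment \<alpha>. \<forall>\<nu>\<in>prob_moment \<alpha> :: 'a measure set. \<kappa> * (LINT v|\<mu>. norm v powr \<alpha>)
        \<le> T \<nu> + enn2real (\<integral>\<^sup>+\<xi>. ennreal (norm (L_diff \<mu> \<xi> - L_diff \<nu> \<xi>)) \<partial>riesz \<alpha>)"
      by blast
    define \<mu> where "\<mu> n = \<sigma> (n + N0)" for n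
    have "(LINT v|\<mu> n. norm v powr \<alpha>) \<le> (T (\<sigma> N0) + 1) / \<kappa>" for n
    proof -
      have "(\<integral>\<^sup>+\<xi>. ennreal (norm (L_diff (\<mu> n) \<xi> - L_diff (\<sigma> N0) \<xi>)) \<partial>riesz \<alpha>) \<le> total_dist (\<mu> n) (\<sigma> N0)"
        using \<sigma> by (simp add: \<mu>_def total_dist_eq)
      also have "\<dots> \<le> ennreal 1" using N0[of "n + N0"] by (simp add: \<mu>_def)
      finally have "enn2real (\<integral>\<^sup>+\<xi>. ennreal (norm (L_diff (\<mu> n) \<xi> - L_diff (\<sigma> N0) \<xi>)) \<partial>riesz \<alpha>) \<le> 1"
        by (rule enn2real_leI[rotated]) simp
      then have "\<kappa> * (LINT v|\<mu> n. norm v powr \<alpha>) \<le> T (\<sigma> N0) + 1"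
        using bspec[OF bspec[OF T \<sigma>[of "n + N0"]] \<sigma>[of N0]] by (simp add: \<mu>_def)
      then show ?thesis using \<kappa> by (simp add: le_divide_eq mult.commute)
    qed
    moreover have "\<mu> n \<in> prob_moment \<alpha>" for n by (simp add: \<mu>_def \<sigma>)
    ultimately obtain r \<nu> where r: "strict_mono r" and \<nu>: "\<nu> \<in> prob_moment \<alpha>"
      and lim: "\<And>\<xi>. (\<lambda>n. fourier (\<mu> (r n)) \<xi>) \<longlonglongrightarrow> fourier \<nu> \<xi>"
      using moment_bounded_weakly_convergent_subsequence[OF \<alpha>(1), of \<mu> "(T (\<sigma> N0) + 1) / \<kappa>"] by blast
    have "\<exists>N. \<forall>n\<ge>N. enn2real (total_dist (\<sigma> n) \<nu>) < \<epsilon>" if \<epsilon>: "0 < \<epsilon>" for \<epsilon>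
    proof -
      obtain N where N: "\<And>n n'. N \<le> n \<Longrightarrow> N \<le> n' \<Longrightarrow> total_dist (\<sigma> n) (\<sigma> n') < ennreal (\<epsilon> / 3)"
        using cauchy[of "\<epsilon> / 3"] \<epsilon> by auto
      have "enn2real (total_dist (\<sigma> n) \<nu>) < \<epsilon>" if n: "N \<le> n" for n
      proof -
        have "total_dist (\<sigma> n) \<nu> \<le> ennreal (\<epsilon> / 3) + ennreal (\<epsilon> / 3)"
        proof (rule total_dist_le_of_fourier_limit[OF \<sigma> _ \<nu> lim])
          show "\<mu> (r j) \<in> prob_moment \<alpha>" for j using \<sigma> by (simp add: \<mu>_def)
          show "\<forall>\<^sub>F j in sequentially. total_dist (\<sigma> n) (\<mu> (r j)) \<le> ennreal (\<epsilon> / 3)"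
            using eventually_ge_at_top[of N]
          proof eventually_elim
            case (elim j)
            then have "N \<le> r j + N0" using seq_suble[OF r, of j] by linarith
            then show ?case using N[OF n] by (simp add: \<mu>_def less_imp_le)
          qed
        qed (use \<epsilon> in auto)
        also have "\<dots> = ennreal (2 * \<epsilon> / 3)"
          using \<epsilon> by (simp add: ennreal_plus[symmetric] del: ennreal_plus)
        also have "\<dots> < ennreal \<epsilon>" using \<epsilon> by (simp add: ennreal_lessI)
        finally show ?thesis using enn2real_total_dist_less_iff[OF \<sigma> \<nu> \<epsilon>] by simp
      qed
      then show ?thesis by blast
    qed
    then have "limitin M.mtopology \<sigma> \<nu> sequentially"
      using \<sigma> \<nu> by (auto simp: M.limitin_metric eventually_sequentially)
    then show ?thesis ..
  qed
  then have "M.mcomplete" unfolding M.mcomplete_def by blast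
  then show ?thesis
    unfolding complete_metric_on_def using total_dist_finite Metric_space_total_dist by blast
qed

end

section \<open>The two metrics\<close>

text \<open>  Write \<open>exp (- \<i> s) - 1\<close> as \<open>- 2 \<i> sin (s/2)\<close> times \<open>exp (- \<i> s / 2)\<close>.  For odd \<open>k\<close> the \<open>k\<close>-th power of the first factor is purely
  imaginary, so the real part picks up the sine of the phase \<open>k s / 2\<close>, which is one more zero at \<open>s = 0\<close>.\<close>

lemma Re_diff_kernel_odd_le:
  assumes "odd k"
  shows "\<bar>Re (diff_kernel k s)\<bar> \<le> real k * \<bar>s\<bar> ^ Suc k"
proof -
  define y where "y = Im ((- 2 * \<i> * complex_of_real (sin (s/2))) ^ k)"
  have e: "exp (- \<i> * complex_of_real s) - 1 = (- 2 * \<i> * complex_of_real (sin (s/2))) * cis (- s/2)"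
  proof -
    have 1: "cos s = 1 - 2 * (sin (s/2))\<^sup>2" "sin s = 2 * sin (s/2) * cos (s/2)"
      using cos_double_sin[of "s/2"] sin_double[of "s/2"] by simp_all
    show ?thesis
      by (simp add: complex_eq_iff Re_exp Im_exp 1 power2_eq_square)
  qed
  have "(- 2 * \<i> * complex_of_real (sin (s/2))) ^ k = \<i> * complex_of_real y"
  proof -
    obtain j where j: "k = 2 * j + 1" using assms by (elim oddE)
    have "(- 2 * \<i> * complex_of_real (sin (s/2)))\<^sup>2 = complex_of_real (- 4 * (sin (s/2))\<^sup>2)"
      by (simp add: power_mult_distrib)
    then have "(- 2 * \<i> * complex_of_real (sin (s/2))) ^ k
       = complex_of_real (- 4 * (sin (s/2))\<^sup>2) ^ j * (- 2 * \<i> * complex_of_real (sin (s/2)))"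
      unfolding j power_add power_mult by simp
    then have "Re ((- 2 * \<i> * complex_of_real (sin (s/2))) ^ k) = 0"
      by (simp flip: of_real_power)
    then show ?thesis by (simp add: complex_eq_iff y_def)
  qed
  moreover have "diff_kernel k s = (- 2 * \<i> * complex_of_real (sin (s/2))) ^ k * cis (- s/2) ^ k"
    unfolding diff_kernel_def e by (rule power_mult_distrib)
  ultimately have "diff_kernel k s = \<i> * complex_of_real y * cis (real k * (- s/2))"
    by (simp only: Complex.DeMoivre)
  then have "Re (diff_kernel k s) = y * sin (real k * s / 2)"
    by simp
  moreover have "\<bar>y\<bar> \<le> \<bar>s\<bar> ^ k"
  proof -
    have "\<bar>y\<bar> \<le> norm ((- 2 * \<i> * complex_of_real (sin (s/2))) ^ k)"
      unfolding y_def by (rule abs_Im_le_cmod)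
    also have "\<dots> = (2 * \<bar>sin (s/2)\<bar>) ^ k" by (simp add: norm_power norm_mult)
    also have "\<dots> \<le> \<bar>s\<bar> ^ k"
      using abs_sin_x_le_abs_x[of "s/2"] by (intro power_mono) auto
    finally show ?thesis .
  qed
  moreover have "\<bar>sin (real k * s / 2)\<bar> \<le> real k * \<bar>s\<bar>"
    using abs_sin_x_le_abs_x[of "real k * s / 2"] by (simp add: abs_mult)
  ultimately have "\<bar>Re (diff_kernel k s)\<bar> \<le> \<bar>s\<bar> ^ k * (real k * \<bar>s\<bar>)"
    by (simp only: abs_mult) (intro mult_mono; simp)
  then show ?thesis by (simp add: mult_ac)
qed

text \<open>  The choice is \<open>p = \<lfloor>\<alpha> / 2\<rfloor> + 1\<close>.  When \<open>\<alpha>\<close> exceeds \<open>k\<close>, parity of \<open>k\<close> is what keeps \<open>2 * p - 2\<close> below \<open>k\<close>.\<close>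

lemma exists_half_floor:
  assumes "0 < \<alpha>" "\<And>n::nat. \<alpha> \<noteq> 2 * real n" "\<alpha> < real k + 1" "odd k \<or> \<alpha> < real k"
  obtains p :: nat where "0 < p" "2 * real p - 2 < \<alpha>" "\<alpha> < 2 * real p" "2 * p \<le> Suc k"
proof -
  define p where "p = nat \<lfloor>\<alpha> / 2\<rfloor> + 1"
  define f where "f = real_of_int \<lfloor>\<alpha> / 2\<rfloor>"
  have f: "f \<le> \<alpha> / 2" "\<alpha> / 2 < f + 1"
    unfolding f_def by (rule of_int_floor_le, rule real_of_int_floor_add_one_gt)
  have r: "real p = f + 1" using assms(1) by (simp add: p_def f_def)
  have "2 * real p - 2 \<le> \<alpha>" unfolding r using f(1) by (simp add: field_simps)
  moreover have "\<alpha> < 2 * real p" unfolding r using f(2) by (simp add: field_simps)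
  moreover have "2 * real p - 2 \<noteq> \<alpha>"
    using assms(2)[of "p - 1"] by (auto simp: p_def)
  moreover have "2 * p \<le> Suc k"
  proof -
    have "2 * real p < real k + 3" using calculation(1) assms(3) by linarith
    then have 1: "2 * p < k + 3" by linarith
    show ?thesis
    proof (cases "odd k")
      case True
      have "even (2 * p)" "odd (k + 2)" using True by auto
      then have "2 * p \<noteq> k + 2" by metis
      then show ?thesis using 1 by linarith
    next
      case False
      then have "2 * real p < real k + 2" using calculation(1) assms(4) by linarith
      then have "2 * p < k + 2" by linarith
      then show ?thesis by simp
    qed
  qed
  ultimately show ?thesis using that[of p] by (auto simp: p_def)
qed

theorem theorem3:
  fixes k :: nat
  assumes "k > 0"
  shows "(\<forall>\<alpha> \<beta> :: real.
            \<alpha> \<notin> \<int> \<and> 0 < \<alpha> \<and> \<alpha> < real k \<and> 0 < \<beta> \<and> \<beta> \<le> min \<alpha> 1 \<longrightarrow>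
            complete_metric_on (prob_moment \<alpha> :: (real ^ 'n) measure set) (F_dist k \<alpha> \<beta>)) \<and>
         (\<forall>\<alpha> \<beta> :: real.
            odd k \<and> (\<alpha> \<notin> \<int> \<and> 0 < \<alpha> \<and> \<alpha> < real k + 1 \<or> \<alpha> = real k) \<and>
            0 < \<beta> \<and> \<beta> \<le> min \<alpha> 1 \<longrightarrow>
            complete_metric_on (prob_moment \<alpha> :: (real ^ 'n) measure set) (H_dist k \<alpha> \<beta>))"
proof (intro conjI allI impI)
  fix \<alpha> \<beta> :: real
  assume *: "\<alpha> \<notin> \<int> \<and> 0 < \<alpha> \<and> \<alpha> < real k \<and> 0 < \<beta> \<and> \<beta> \<le> min \<alpha> 1"
  have ni: "\<alpha> \<noteq> real n" for n using * by auto
  obtain p :: nat where p: "0 < p" "2 * real p - 2 < \<alpha>" "\<alpha> < 2 * real p" "2 * p \<le> Suc k"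
  proof (rule exists_half_floor[of \<alpha> k])
    show "\<alpha> \<noteq> 2 * real n" for n using ni[of "2 * n"] by simp
  qed (use * in auto)
  interpret F: fourier_difference_metric "\<lambda>z::complex. z" k p \<alpha> \<beta> "real k" "2 ^ k"
  proof (rule fourier_difference_metric.intro)
    show "norm (diff_kernel k s) \<le> 2 ^ k * min (\<bar>s\<bar> powr real k) (\<bar>s\<bar> powr 0)" for s
    proof (cases "s = 0")
      case True
      then show ?thesis using assms by (simp add: diff_kernel_def power_0_left)
    next
      case False
      have "norm (diff_kernel k s) \<le> \<bar>s\<bar> ^ k"
        unfolding diff_kernel_def norm_power by (intro power_mono norm_exp_minus_one_le) auto
      also have "\<dots> \<le> 2 ^ k * \<bar>s\<bar> ^ k"
        by (simp add: mult_le_cancel_right1)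
      finally show ?thesis
        using norm_diff_kernel_le[of k s] False by (simp add: powr_realpow min_def)
    qed
  qed (use * assms p ni in \<open>auto simp: abs_Re_le_cmod bounded_linear_ident\<close>)
  have "F_dist k \<alpha> \<beta> = (F.total_dist :: (real ^ 'n) measure \<Rightarrow> _)"
    by (intro ext) (simp add: F_dist_def F.total_dist_def)
  then show "complete_metric_on (prob_moment \<alpha> :: (real ^ 'n) measure set) (F_dist k \<alpha> \<beta>)"
    using F.complete_metric_total_dist[where 'a="real ^ 'n"] by simp
next
  fix \<alpha> \<beta> :: real
  assume *: "odd k \<and> (\<alpha> \<notin> \<int> \<and> 0 < \<alpha> \<and> \<alpha> < real k + 1 \<or> \<alpha> = real k) \<and> 0 < \<beta> \<and> \<beta> \<le> min \<alpha> 1"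
  have a: "0 < \<alpha>" "\<alpha> < real k + 1" using * assms by auto
  have ni: "\<alpha> \<noteq> real j" if "j < k" for j using * that by auto
  obtain p :: nat where p: "0 < p" "2 * real p - 2 < \<alpha>" "\<alpha> < 2 * real p" "2 * p \<le> Suc k"
  proof (rule exists_half_floor[of \<alpha> k])
    show "\<alpha> \<noteq> 2 * real n" for n
    proof
      assume eq: "\<alpha> = 2 * real n"
      then have "\<alpha> \<in> \<int>" by simp
      then have "real (2 * n) = real k" using * eq by auto
      then have "2 * n = k" by linarith
      then show False using * by auto
    qed
  qed (use * a in auto)
  interpret H: fourier_difference_metric Re k p \<alpha> \<beta> "real k + 1" "max (real k) (2 ^ k)"
  proof (rule fourier_difference_metric.intro)
    show "norm (Re (diff_kernel k s)) \<le> max (real k) (2 ^ k) * min (\<bar>s\<bar> powr (real k + 1)) (\<bar>s\<bar> powr 0)" for s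
    proof (cases "s = 0")
      case True
      then show ?thesis using assms by (simp add: diff_kernel_def power_0_left)
    next
      case False
      have "\<bar>Re (diff_kernel k s)\<bar> \<le> real k * \<bar>s\<bar> ^ Suc k"
        using * by (intro Re_diff_kernel_odd_le) auto
      also have "\<dots> \<le> max (real k) (2 ^ k) * \<bar>s\<bar> ^ Suc k"
        by (intro mult_right_mono) auto
      finally have 1: "\<bar>Re (diff_kernel k s)\<bar> \<le> max (real k) (2 ^ k) * \<bar>s\<bar> powr (real k + 1)"
        using False powr_realpow[of "\<bar>s\<bar>" "Suc k"] by (simp add: add.commute)
      have "\<bar>Re (diff_kernel k s)\<bar> \<le> 2 ^ k"
        using abs_Re_le_cmod norm_diff_kernel_le order.trans by blast
      then have "\<bar>Re (diff_kernel k s)\<bar> \<le> max (real k) (2 ^ k) * \<bar>s\<bar> powr 0"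
        using False by simp
      then show ?thesis using 1 by (simp only: min_def real_norm_def simp_thms split: if_split)
    qed
  qed (use * assms p ni a in \<open>auto simp: abs_Re_le_cmod bounded_linear_Re odd_pos\<close>)
  have "H_dist k \<alpha> \<beta> = (H.total_dist :: (real ^ 'n) measure \<Rightarrow> _)"
    by (intro ext) (simp add: H_dist_def H.total_dist_def)
  then show "complete_metric_on (prob_moment \<alpha> :: (real ^ 'n) measure set) (H_dist k \<alpha> \<beta>)"
    using H.complete_metric_total_dist[where 'a="real ^ 'n"] by simp
qed

end
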